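(* Let $H:\mathbb{R}^N\to\mathbb{R}$ be a (differentiable) energy function with the equation $$\frac{du}{dt}=S\frac{\partial H}{\partial u},$$ where $u:t\in\mathbb{R}\mapsto u(t)\in\mathbb{R}^N$ and $S$ is a skew-symmetric $N\times N$ real matrix. Suppose that the phase space $K\subset\mathbb{R}^N$ of this system is compact and that the right-hand side $S\,\partial H/\partial u$ is Lipschitz continuous on $K$. If the activation function $\sigma\neq0$ belongs to $S^1_2(\mathbb{R})$, then for any $\varepsilon>0$ there exists a neural network $H_{\mathrm{NN}}:\mathbb{R}^N\to\mathbb{R}$ with activation function $\sigma$ for which $$\left\|S\frac{\partial H}{\partial u}-S\frac{\partial H_{\mathrm{NN}}}{\partial u}\right\|_{L^2(K)}<\varepsilon .$$ In addition, if $H$ is $C^\infty$ and the activation function is sufficiently smooth (i.e. $\sigma$ is moreover $C^\infty$), then $H_{\mathrm{NN}}$ can be taken to be a $C^\infty$ neural network.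
   Context: $\partial H/\partial u$ is the gradient of $H$ (a column vector). For an integer $m\ge0$ and $1\le p\le\infty$, $W^{p,m}(X)$ is the Sobolev space of functions on $X$ having weak derivatives up to order $m$ in $L^p$, and $S^m_p(X)$ is $C^m(X)$ with the topology of $W^{p,m}(X)$, i.e. the space of functions in $W^{p,m}(X)$ with (usual) derivatives up to order $m$. In particular $\sigma\in S^1_2(\mathbb{R})$ means that $\sigma$ is $C^1$ with $\sigma,\sigma'\in L^2(\mathbb{R})$; $\sigma\neq0$ means that $\sigma$ is not identically zero. A neural network with activation function $\sigma$ is an element of $\Sigma(\sigma)$, the set of one-hidden-layer networks $x\mapsto\sum_{j=1}^q\beta_j\,\sigma(a_j\cdot x+b_j)$ with $q\in\mathbb{N}$, $\beta_j,b_j\in\mathbb{R}$, $a_j\in\mathbb{R}^N$. *)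

theory Defs
  imports "HOL-Analysis.Analysis"
begin

definition gradient :: "('a::real_inner \<Rightarrow> real) \<Rightarrow> 'a \<Rightarrow> 'a" where
  "gradient f x = (THE D. GDERIV f x :> D)"

lemma gradient_eqI:
  assumes "GDERIV f x :> D"
  shows "gradient f x = D"
  unfolding gradient_def
proof (rule the_equality)
  fix E assume "GDERIV f x :> E"
  then have "(\<lambda>h. inner h E) = (\<lambda>h. inner h D)"
    using assms has_derivative_unique unfolding gderiv_def by blast
  then show "E = D"
    by (metis vector_eq_rdot inner_commute)
qed (rule assms)

definition in_L2 :: "'a::euclidean_space set \<Rightarrow> ('a \<Rightarrow> 'b::euclidean_space) \<Rightarrow> bool" where
  "in_L2 X f \<longleftrightarrow> f \<in> borel_measurable (lebesgue_on X) \<and>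
     integrable (lebesgue_on X) (\<lambda>x. (norm (f x))\<^sup>2)"

(* Meaningful only together with in_L2 X f: the Bochner integral of a
   non-integrable function is 0. *)
definition L2_norm :: "'a::euclidean_space set \<Rightarrow> ('a \<Rightarrow> 'b::euclidean_space) \<Rightarrow> real" where
  "L2_norm X f = sqrt (integral\<^sup>L (lebesgue_on X) (\<lambda>x. (norm (f x))\<^sup>2))"

(* The space S^1_2(R). For a C^1 function the weak derivative is the classical one. *)
definition S12 :: "(real \<Rightarrow> real) set" where
  "S12 = {\<sigma>. \<sigma> C1_differentiable_on UNIV \<and> in_L2 UNIV \<sigma> \<and> in_L2 UNIV (deriv \<sigma>)}"

primrec C_k :: "nat \<Rightarrow> ('a::euclidean_space \<Rightarrow> real) \<Rightarrow> bool" where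
  "C_k 0 f \<longleftrightarrow> continuous_on UNIV f"
| "C_k (Suc k) f \<longleftrightarrow> (\<forall>x. f differentiable (at x)) \<and>
     (\<forall>b\<in>Basis. C_k k (\<lambda>x. frechet_derivative f (at x) b))"

definition C_inf :: "('a::euclidean_space \<Rightarrow> real) \<Rightarrow> bool" where
  "C_inf f \<longleftrightarrow> (\<forall>k. C_k k f)"

(* Allowing q = 0 adds nothing: the zero function is also the network with
   q = 1 and \<beta> 0 = 0. *)
definition neural_networks :: "(real \<Rightarrow> real) \<Rightarrow> (real ^ 'n \<Rightarrow> real) set" where
  "neural_networks \<sigma> =
     {f. \<exists>(q::nat) (\<beta> :: nat \<Rightarrow> real) (a :: nat \<Rightarrow> real ^ 'n) (b :: nat \<Rightarrow> real).
           f = (\<lambda>x. \<Sum>j<q. \<beta> j * \<sigma> (a j \<bullet> x + b j))}"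

end

theory Submission
  imports Defs
begin

text \<open>
The right-hand side \<open>f = S \<nabla>H\<close> is continuous on \<open>K\<close>, but \<open>H\<close> itself is only differentiable: off \<open>K\<close>,
and on \<open>K\<close> in the directions of the kernel of \<open>S\<close>, its gradient may be wild, and \<open>K\<close> may be a totally
disconnected set. So \<open>H\<close> cannot simply be mollified. The proof nevertheless gives approximation of
\<open>f\<close> uniformly on \<open>K\<close>, from which the \<open>L\<^sup>2\<close> statement follows because \<open>K\<close> has finite measure. Writing
\<open>B = S\<^sup>T\<close>, one has \<open>f x \<bullet> w = \<nabla>H x \<bullet> B w\<close>, so only difference quotients in the directions \<open>B w\<close> matter.

From differentiable to tame. By differentiability, \<open>K\<close> is a countable union of pieces \<open>E j\<close> of small
diameter, on each of which one slope \<open>p\<close> gives a first order approximation of \<open>H\<close> at every point of the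
piece, with relative error \<open>e\<close> and on a scale \<open>R j\<close>. A McShane extension then gives a function
\<open>A j\<close> whose increments have slope \<open>p\<close> up to the error \<open>e\<close> and which differs from \<open>H\<close> near
\<open>E j\<close> by at most \<open>2 e\<close> times the distance to \<open>E j\<close> (\<open>nearly_affine_extension\<close>). By compactness, finitely many tiny
neighbourhoods of the pieces cover \<open>K\<close>, and the \<open>A j\<close> are blended from the last to the first. A blend
costs the slope of the cutoff times the discrepancy of the blended functions; the discrepancy is
\<open>O(e d)\<close> at distance \<open>d\<close> from the piece, so a logarithmic cutoff, whose slope is \<open>\<kappa> / d\<close> with
\<open>\<kappa>\<close> as small as one wishes, makes the costs summable (\<open>blend_countable_cover\<close>). The result
\<open>local_approximation_of_differentiable\<close> is a continuous \<open>G\<close> whose increments along the \<open>B w\<close> agree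
with \<open>f\<close> up to \<open>O(e)\<close> at all small scales, not just in the limit. This property survives convolution
with a compactly supported kernel, which makes \<open>G\<close> continuously differentiable
(\<open>mollify_grad_directional\<close>).

From tame to networks. Call a pair of a function and its gradient approximable if networks converge to
it in \<open>C\<^sup>1\<close> on compact sets. In one variable, the \<open>k\<close>-fold moving average of \<open>\<sigma>\<close> is approximable, being
a limit of Riemann sums of translates, and its \<open>k\<close>-th derivative is the \<open>k\<close>-th forward difference of
\<open>\<sigma>\<close>. This is not identically zero, since a periodic function in \<open>L\<^sup>2\<close> vanishes. Differentiating
\<open>g (a t + b)\<close> \<open>k\<close> times in the parameter \<open>a\<close> at \<open>a = 0\<close> produces the monomial \<open>t\<^sup>k\<close> up to a nonzero factor, and the
Weierstrass theorem for derivatives produces every \<open>C\<^sup>1\<close> function of one variable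
(\<open>C1_approx_compacts_C1\<close>), in particular the exponential. In several variables, differentiating
\<open>p x * exp (a \<bullet> x)\<close> in the parameter \<open>a\<close> multiplies \<open>p\<close> by a linear form, so all polynomials are
approximable, hence so is the kernel \<open>(max 0 (r\<^sup>2 - |x - z|\<^sup>2))\<^sup>2\<close> and, again by Riemann sums, any
convolution with it.
\<close>

section \<open>Blending nearly affine pieces of a differentiable function\<close>

text \<open>As a function of the distance \<open>s\<close> to a set, this is 1 up to distance \<open>\<rho>\<close> and then decays linearly in
\<open>ln s\<close>. The price of the small slope \<open>\<kappa> / s\<close> is the large ratio \<open>exp (1 / \<kappa>)\<close> between the radius where
it reaches 0 and the radius \<open>\<rho>\<close>; the radii can be chosen freely, so this price is harmless.\<close>
definition log_cutoff :: "real \<Rightarrow> real \<Rightarrow> real \<Rightarrow> real" where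
  "log_cutoff \<kappa> \<rho> s = max 0 (1 - \<kappa> * ln (max s \<rho> / \<rho>))"

lemma log_cutoff_range:
  assumes "0 < \<kappa>" "0 < \<rho>"
  shows "0 \<le> log_cutoff \<kappa> \<rho> s" "log_cutoff \<kappa> \<rho> s \<le> 1"
  using assms by (auto simp: log_cutoff_def)

lemma log_cutoff_eq_1: "0 < \<rho> \<Longrightarrow> s \<le> \<rho> \<Longrightarrow> log_cutoff \<kappa> \<rho> s = 1"
  by (simp add: log_cutoff_def)

lemma log_cutoff_eq_0:
  assumes "0 < \<kappa>" "0 < \<rho>" "exp (1 / \<kappa>) * \<rho> \<le> s"
  shows "log_cutoff \<kappa> \<rho> s = 0"
proof -
  have "1 \<le> exp (1 / \<kappa>)" using assms by simp
  then have "\<rho> \<le> exp (1 / \<kappa>) * \<rho>" using assms by simp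
  then have "exp (1 / \<kappa>) \<le> max s \<rho> / \<rho>" using assms by (simp add: field_simps)
  then have "ln (exp (1 / \<kappa>)) \<le> ln (max s \<rho> / \<rho>)"
    by (intro ln_mono) (use assms in \<open>auto simp: max_def\<close>)
  then have "1 \<le> \<kappa> * ln (max s \<rho> / \<rho>)" using assms by (simp add: field_simps)
  then show ?thesis by (simp add: log_cutoff_def)
qed

lemma continuous_on_log_cutoff [continuous_intros]:
  assumes "0 < \<rho>" "continuous_on X d"
  shows "continuous_on X (\<lambda>x. log_cutoff \<kappa> \<rho> (d x))"
  unfolding log_cutoff_def
  by (intro continuous_intros assms) (use assms in \<open>auto simp: max_def\<close>)

text \<open>The slope bound \<open>\<kappa> / s\<close>, integrated: it rests on \<open>ln x \<le> x - 1\<close>.\<close>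
lemma log_cutoff_variation:
  assumes "0 < \<kappa>" "0 < \<rho>"
  shows "\<bar>log_cutoff \<kappa> \<rho> s - log_cutoff \<kappa> \<rho> t\<bar> * max \<rho> (min s t) \<le> \<kappa> * \<bar>s - t\<bar>"
proof -
  have *: "\<bar>log_cutoff \<kappa> \<rho> s - log_cutoff \<kappa> \<rho> t\<bar> * max \<rho> (min s t) \<le> \<kappa> * \<bar>s - t\<bar>"
    if "s \<le> t" for s t
  proof -
    define a where "a = max s \<rho>"
    define b where "b = max t \<rho>"
    have ab: "0 < a" "a \<le> b" "b - a \<le> \<bar>s - t\<bar>" "max \<rho> (min s t) = a"
      using that assms by (auto simp: a_def b_def)
    have "ln (b / \<rho>) - ln (a / \<rho>) = ln (b / a)"
      using ab assms by (simp add: ln_div)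
    also have "\<dots> \<le> b / a - 1" using ab by (intro ln_le_minus_one) auto
    finally have 1: "(ln (b / \<rho>) - ln (a / \<rho>)) * a \<le> b - a"
      using ab by (simp add: field_simps)
    have 2: "ln (a / \<rho>) \<le> ln (b / \<rho>)" using ab assms by (simp add: divide_right_mono)
    have "\<bar>log_cutoff \<kappa> \<rho> s - log_cutoff \<kappa> \<rho> t\<bar> \<le> \<bar>\<kappa> * ln (a / \<rho>) - \<kappa> * ln (b / \<rho>)\<bar>"
      unfolding log_cutoff_def a_def b_def by linarith
    also have "\<dots> = \<kappa> * (ln (b / \<rho>) - ln (a / \<rho>))"
      using 2 assms by (simp add: abs_if algebra_simps)
    finally have "\<bar>log_cutoff \<kappa> \<rho> s - log_cutoff \<kappa> \<rho> t\<bar> * a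
        \<le> \<kappa> * (ln (b / \<rho>) - ln (a / \<rho>)) * a"
      using ab by (intro mult_right_mono) auto
    also have "\<dots> \<le> \<kappa> * (b - a)" using 1 assms by (simp add: mult.assoc)
    also have "\<dots> \<le> \<kappa> * \<bar>s - t\<bar>" using ab assms by simp
    finally show ?thesis using ab by simp
  qed
  show ?thesis
    using *[of s t] *[of t s] by (cases "s \<le> t") (auto simp: abs_minus_commute min.commute)
qed

text \<open>The second clause is a form of ``\<open>\<nabla>G z \<bullet> B w\<close> is within \<open>c * norm w\<close> of \<open>f z \<bullet> w\<close>'' that makes sense for a
\<open>G\<close> without derivatives: it speaks of all increments inside a ball, with one radius for all of \<open>Z\<close>.
The first clause is carried along because the cost of the next blend depends on it.\<close>
definition locally_fits ::
  "('a::euclidean_space \<Rightarrow> real) \<Rightarrow> ('a \<Rightarrow> 'b::euclidean_space) \<Rightarrow> ('b \<Rightarrow> 'a) \<Rightarrow> ('a \<Rightarrow> real)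
    \<Rightarrow> 'a set \<Rightarrow> real \<Rightarrow> real \<Rightarrow> real \<Rightarrow> bool" where
  "locally_fits H f B G Z r q c \<longleftrightarrow> (\<forall>z\<in>Z.
     (\<forall>y\<in>ball z r. \<bar>G y - H y\<bar> \<le> q) \<and>
     (\<forall>y w. y \<in> ball z r \<longrightarrow> y + B w \<in> ball z r \<longrightarrow>
        \<bar>G (y + B w) - G y - f z \<bullet> w\<bar> \<le> c * norm w))"

lemma abs_weighted_sum_le:
  fixes a b :: real
  assumes "0 \<le> a" "0 \<le> b"
  shows "\<bar>a * x + b * y + c * z\<bar> \<le> a * \<bar>x\<bar> + b * \<bar>y\<bar> + \<bar>c\<bar> * \<bar>z\<bar>"
proof -
  have "\<bar>a * x\<bar> = a * \<bar>x\<bar>" "\<bar>b * y\<bar> = b * \<bar>y\<bar>" using assms by (simp_all add: abs_mult)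
  then show ?thesis using abs_mult[of c z] by linarith
qed

text \<open>Near \<open>E\<close> the blend is \<open>A\<close>, far from it \<open>G\<close>, which therefore needs to be good only at points at distance
at least \<open>\<rho> / 2\<close>. In between, the increment of the blend is a convex combination of the two increments
plus (increment of the cutoff) times \<open>A - G\<close>. Both \<open>A\<close> and \<open>G\<close> are close to \<open>H\<close>, so that the last
factor is at most \<open>6 e \<mu>\<close>, where \<open>\<mu>\<close> is the maximum of \<open>\<rho>\<close> and the distance to \<open>E\<close>. Here \<open>\<mu>\<close>
cancels the denominator in the slope of the cutoff, and \<open>6 e \<kappa>\<close> remains.\<close>
lemma blend_step:
  fixes A G H :: "'a::euclidean_space \<Rightarrow> real" and f :: "'a \<Rightarrow> 'b::euclidean_space"
  assumes e: "0 < e" and \<Lambda>: "\<And>w. norm (B w) \<le> \<Lambda> * norm w" and \<rho>: "0 < \<rho>" and \<kappa>: "0 < \<kappa>"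
    and R: "2 * (exp (1 / \<kappa>) * \<rho>) \<le> R"
    and A1: "\<And>y. infdist y E < R \<Longrightarrow> \<bar>A y - H y\<bar> \<le> 2 * e * infdist y E"
    and A2: "\<And>z y w. z \<in> Z \<Longrightarrow> infdist z E < R \<Longrightarrow>
               \<bar>A (y + B w) - A y - f z \<bullet> w\<bar> \<le> c0 * norm w"
    and G: "locally_fits H f B G {z \<in> Z. \<rho> / 2 \<le> infdist z E} r' q' c'"
    and r': "0 < r'" and q': "q' \<le> 2 * e * \<rho>" and c': "c0 \<le> c'"
  defines "G' \<equiv> \<lambda>y. log_cutoff \<kappa> \<rho> (infdist y E) * A y + (1 - log_cutoff \<kappa> \<rho> (infdist y E)) * G y"
  shows "\<exists>r>0. locally_fits H f B G' Z r (2 * e * (exp (1 / \<kappa>) * \<rho>)) (c' + 6 * e * \<Lambda> * \<kappa>)"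
proof -
  define M where "M = exp (1 / \<kappa>)"
  define \<psi> where "\<psi> y = log_cutoff \<kappa> \<rho> (infdist y E)" for y
  have G'_def: "G' y = \<psi> y * A y + (1 - \<psi> y) * G y" for y
    by (simp add: G'_def \<psi>_def)
  have M1: "1 \<le> M" using \<kappa> by (simp add: M_def)
  then have M\<rho>: "\<rho> \<le> M * \<rho>" using \<rho> by simp
  have MR: "2 * (M * \<rho>) \<le> R" using R by (simp add: M_def)
  have \<Lambda>0: "0 \<le> \<Lambda> * norm w" for w :: 'b using \<Lambda>[of w] norm_ge_zero order_trans by blast
  define r where "r = min r' (\<rho> / 4)"
  have r: "0 < r" "r \<le> r'" "r \<le> \<rho> / 4" using r' \<rho> by (auto simp: r_def)
  have \<psi>01: "0 \<le> \<psi> y" "\<psi> y \<le> 1" for y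
    using log_cutoff_range[OF \<kappa> \<rho>] by (auto simp: \<psi>_def)
  have \<psi>pos: "infdist y E < M * \<rho>" if "\<psi> y \<noteq> 0" for y
    using that log_cutoff_eq_0[OF \<kappa> \<rho>, of "infdist y E"] unfolding \<psi>_def M_def by force
  have dz: "\<bar>infdist y E - infdist z E\<bar> < r" if "y \<in> ball z r" for y z
    using infdist_triangle_abs[of y E z] that by (simp add: dist_commute)
  have fit: "(\<forall>y\<in>ball z r. \<bar>G' y - H y\<bar> \<le> 2 * e * (M * \<rho>)) \<and>
     (\<forall>y w. y \<in> ball z r \<longrightarrow> y + B w \<in> ball z r \<longrightarrow>
        \<bar>G' (y + B w) - G' y - f z \<bullet> w\<bar> \<le> (c' + 6 * e * \<Lambda> * \<kappa>) * norm w)"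
    if z: "z \<in> Z" for z
  proof (cases "infdist z E < \<rho> / 2")
    case True
    have eq: "G' y = A y" "infdist y E \<le> \<rho>" if "y \<in> ball z r" for y
    proof -
      show "infdist y E \<le> \<rho>" using dz[OF that] True r by linarith
      then have "\<psi> y = 1" using log_cutoff_eq_1[OF \<rho>] by (simp add: \<psi>_def)
      then show "G' y = A y" by (simp add: G'_def)
    qed
    have "\<bar>G' y - H y\<bar> \<le> 2 * e * (M * \<rho>)" if y: "y \<in> ball z r" for y
    proof -
      have "\<bar>A y - H y\<bar> \<le> 2 * e * infdist y E"
        using eq(2)[OF y] M\<rho> MR \<rho> by (intro A1) linarith
      also have "\<dots> \<le> 2 * e * (M * \<rho>)"
        using eq(2)[OF y] M\<rho> e by (intro mult_left_mono) auto
      finally show ?thesis using eq[OF y] by simp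
    qed
    moreover have "\<bar>G' (y + B w) - G' y - f z \<bullet> w\<bar> \<le> (c' + 6 * e * \<Lambda> * \<kappa>) * norm w"
      if y: "y \<in> ball z r" "y + B w \<in> ball z r" for y w
    proof -
      have "infdist z E < R" using True M\<rho> MR \<rho> by linarith
      from A2[OF z this, of y w] have "\<bar>G' (y + B w) - G' y - f z \<bullet> w\<bar> \<le> c0 * norm w"
        using eq y by simp
      also have "\<dots> \<le> c' * norm w" using c' by (intro mult_right_mono) auto
      also have "\<dots> \<le> (c' + 6 * e * \<Lambda> * \<kappa>) * norm w"
        using mult_nonneg_nonneg[OF \<Lambda>0[of w], of "6 * e * \<kappa>"] e \<kappa> by (simp add: algebra_simps)
      finally show ?thesis .
    qed
    ultimately show ?thesis by blast
  next
    case False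
    then have G1: "\<And>y. y \<in> ball z r \<Longrightarrow> \<bar>G y - H y\<bar> \<le> q'"
      and G2: "\<And>y w. y \<in> ball z r \<Longrightarrow> y + B w \<in> ball z r \<Longrightarrow>
        \<bar>G (y + B w) - G y - f z \<bullet> w\<bar> \<le> c' * norm w"
      using G z r(2) unfolding locally_fits_def by auto
    have "\<bar>G' y - H y\<bar> \<le> 2 * e * (M * \<rho>)" if y: "y \<in> ball z r" for y
    proof -
      have q: "\<bar>G y - H y\<bar> \<le> 2 * e * (M * \<rho>)"
        using G1[OF y] q' M\<rho> e by (smt (verit) mult_left_mono)
      have a: "\<psi> y * \<bar>A y - H y\<bar> \<le> \<psi> y * (2 * e * (M * \<rho>))"
      proof (cases "\<psi> y = 0")
        case False
        then have *: "infdist y E < M * \<rho>" by (rule \<psi>pos)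
        have "\<bar>A y - H y\<bar> \<le> 2 * e * infdist y E" using * M\<rho> MR \<rho> by (intro A1) linarith
        also have "\<dots> \<le> 2 * e * (M * \<rho>)" using * e by (intro mult_left_mono) auto
        finally show ?thesis using \<psi>01 by (intro mult_left_mono)
      qed simp
      have "G' y - H y = \<psi> y * (A y - H y) + (1 - \<psi> y) * (G y - H y)"
        by (simp add: G'_def algebra_simps)
      then have "\<bar>G' y - H y\<bar> \<le> \<psi> y * \<bar>A y - H y\<bar> + (1 - \<psi> y) * \<bar>G y - H y\<bar>"
        using abs_weighted_sum_le[OF \<psi>01(1), of "1 - \<psi> y" y "A y - H y" "G y - H y" 0 0]
          \<psi>01(2)[of y] by simp
      also have "\<dots> \<le> \<psi> y * (2 * e * (M * \<rho>)) + (1 - \<psi> y) * (2 * e * (M * \<rho>))"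
        using mult_left_mono[OF q, of "1 - \<psi> y"] a \<psi>01[of y] by linarith
      finally show ?thesis by (simp add: algebra_simps)
    qed
    moreover have "\<bar>G' (y + B w) - G' y - f z \<bullet> w\<bar> \<le> (c' + 6 * e * \<Lambda> * \<kappa>) * norm w"
      if y: "y \<in> ball z r" "y + B w \<in> ball z r" for y w
    proof -
      define y2 where "y2 = y + B w"
      have a: "\<psi> y * \<bar>A y2 - A y - f z \<bullet> w\<bar> \<le> \<psi> y * (c' * norm w)"
      proof (cases "\<psi> y = 0")
        case False
        then have *: "infdist y E < M * \<rho>" by (rule \<psi>pos)
        then have "infdist z E < R" using dz[OF y(1)] r M\<rho> MR \<rho> by linarith
        from A2[OF z this, of y w] have "\<bar>A y2 - A y - f z \<bullet> w\<bar> \<le> c0 * norm w"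
          by (simp add: y2_def)
        also have "\<dots> \<le> c' * norm w" using c' by (intro mult_right_mono) auto
        finally show ?thesis using \<psi>01 by (intro mult_left_mono)
      qed simp
      have b: "(1 - \<psi> y) * \<bar>G y2 - G y - f z \<bullet> w\<bar> \<le> (1 - \<psi> y) * (c' * norm w)"
        using G2[OF y] \<psi>01 by (intro mult_left_mono) (auto simp: y2_def)
      have d: "\<bar>\<psi> y2 - \<psi> y\<bar> * \<bar>A y2 - G y2\<bar> \<le> 6 * e * \<kappa> * (\<Lambda> * norm w)"
      proof (cases "\<psi> y2 = \<psi> y")
        case True
        then show ?thesis using \<Lambda>0[of w] e \<kappa> by simp
      next
        case False
        \<comment> \<open>The larger of the two distances is at most twice \<open>\<mu>\<close>, because the ball has radius at most \<open>\<rho> / 4\<close>.\<close>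
        define d where "d = min (infdist y2 E) (infdist y E)"
        define \<mu> where "\<mu> = max \<rho> d"
        have "\<psi> y2 \<noteq> 0 \<or> \<psi> y \<noteq> 0" using False by auto
        then have d1: "d < M * \<rho>" using \<psi>pos unfolding d_def by force
        have d2: "infdist y2 E \<le> d + 2 * r"
          using dz[OF y(1)] dz[OF y(2)] unfolding d_def y2_def by linarith
        have "infdist y2 E < R" using d1 d2 r M\<rho> MR \<rho> by linarith
        then have 1: "\<bar>A y2 - H y2\<bar> \<le> 2 * e * infdist y2 E" by (rule A1)
        have 2: "\<bar>G y2 - H y2\<bar> \<le> 2 * e * \<rho>" using G1[of y2] y q' by (simp add: y2_def)
        have 3: "infdist y2 E + \<rho> \<le> 3 * \<mu>" using d2 r \<rho> unfolding \<mu>_def by linarith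
        have "\<bar>A y2 - G y2\<bar> \<le> 2 * e * (infdist y2 E + \<rho>)"
          using 1 2 by (simp add: algebra_simps)
        also have "\<dots> \<le> 2 * e * (3 * \<mu>)" using 3 e by (intro mult_left_mono) auto
        finally have "\<bar>\<psi> y2 - \<psi> y\<bar> * \<bar>A y2 - G y2\<bar> \<le> \<bar>\<psi> y2 - \<psi> y\<bar> * (2 * e * (3 * \<mu>))"
          by (intro mult_left_mono) auto
        also have "\<dots> = 6 * e * (\<bar>\<psi> y2 - \<psi> y\<bar> * \<mu>)" by simp
        also have "\<dots> \<le> 6 * e * (\<kappa> * \<bar>infdist y2 E - infdist y E\<bar>)"
          using log_cutoff_variation[OF \<kappa> \<rho>, of "infdist y2 E" "infdist y E"] e
          unfolding \<psi>_def \<mu>_def d_def by (intro mult_left_mono) auto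
        also have "\<dots> \<le> 6 * e * (\<kappa> * (\<Lambda> * norm w))"
        proof -
          have "\<bar>infdist y2 E - infdist y E\<bar> \<le> dist y2 y" by (rule infdist_triangle_abs)
          also have "\<dots> \<le> \<Lambda> * norm w" using \<Lambda>[of w] by (simp add: y2_def dist_norm)
          finally show ?thesis using e \<kappa> by (intro mult_left_mono) auto
        qed
        finally show ?thesis by (simp add: mult_ac)
      qed
      have "G' y2 - G' y - f z \<bullet> w = \<psi> y * (A y2 - A y - f z \<bullet> w)
         + (1 - \<psi> y) * (G y2 - G y - f z \<bullet> w) + (\<psi> y2 - \<psi> y) * (A y2 - G y2)"
        by (simp add: G'_def algebra_simps)
      then have "\<bar>G' y2 - G' y - f z \<bullet> w\<bar> \<le> \<psi> y * \<bar>A y2 - A y - f z \<bullet> w\<bar>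
         + (1 - \<psi> y) * \<bar>G y2 - G y - f z \<bullet> w\<bar> + \<bar>\<psi> y2 - \<psi> y\<bar> * \<bar>A y2 - G y2\<bar>"
        using abs_weighted_sum_le[OF \<psi>01(1), of "1 - \<psi> y"] \<psi>01(2)[of y] by simp
      also have "\<dots> \<le> \<psi> y * (c' * norm w) + (1 - \<psi> y) * (c' * norm w)
         + 6 * e * \<kappa> * (\<Lambda> * norm w)"
        by (intro add_mono a b d)
      finally show ?thesis by (simp add: y2_def algebra_simps)
    qed
    ultimately show ?thesis by blast
  qed
  then show ?thesis using r unfolding locally_fits_def M_def by blast
qed

text \<open>Blend the functions \<open>A j\<close> from the last index \<open>m\<close> of a finite subcover down to 0. The radii satisfy
\<open>M (Suc n) * \<rho> (Suc n) \<le> \<rho> n\<close>, so that at the moment the \<open>n\<close>-th piece is blended in, the function built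
so far is within \<open>2 e \<rho> n\<close> of \<open>H\<close>. With \<open>\<kappa> n = 2 ^ (- n - 1)\<close> the total cost of all blends is bounded
independently of \<open>m\<close>.\<close>
lemma blend_countable_cover:
  fixes H :: "'a::euclidean_space \<Rightarrow> real" and f :: "'a \<Rightarrow> 'b::euclidean_space"
    and E :: "nat \<Rightarrow> 'a set"
  assumes K: "compact K" and e: "0 < e" and \<Lambda>: "\<And>w. norm (B w) \<le> \<Lambda> * norm w"
    and R: "\<And>j. 0 < R j" and cover: "K \<subseteq> (\<Union>j. E j)"
    and A1: "\<And>j y. infdist y (E j) < R j \<Longrightarrow> \<bar>A j y - H y\<bar> \<le> 2 * e * infdist y (E j)"
    and A2: "\<And>j z y w. z \<in> K \<Longrightarrow> infdist z (E j) < R j \<Longrightarrow>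
               \<bar>A j (y + B w) - A j y - f z \<bullet> w\<bar> \<le> c * norm w"
    and A3: "\<And>j. continuous_on UNIV (A j)"
  obtains G r q where "continuous_on UNIV G" "0 < r"
    "locally_fits H f B G K r q (c + 6 * e * \<Lambda>)"
proof -
  define \<kappa> :: "nat \<Rightarrow> real" where "\<kappa> n = (1/2) ^ Suc n" for n
  define M where "M n = exp (1 / \<kappa> n)" for n
  have \<kappa>: "0 < \<kappa> n" for n by (simp add: \<kappa>_def)
  have M: "0 < M n" for n by (simp add: M_def)
  have "\<exists>\<rho>. \<forall>n. (0 < \<rho> n \<and> 2 * (M n * \<rho> n) \<le> R n) \<and> M (Suc n) * \<rho> (Suc n) \<le> \<rho> n"
  proof (rule dependent_nat_choice)
    show "\<exists>x. 0 < x \<and> 2 * (M 0 * x) \<le> R 0"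
      using R[of 0] M[of 0] by (intro exI[of _ "R 0 / (2 * M 0)"]) auto
  next
    fix x n assume "0 < x \<and> 2 * (M n * x) \<le> R n"
    then show "\<exists>y. (0 < y \<and> 2 * (M (Suc n) * y) \<le> R (Suc n)) \<and> M (Suc n) * y \<le> x"
      using R[of "Suc n"] M[of "Suc n"]
      by (intro exI[of _ "min (R (Suc n) / 2) x / M (Suc n)"]) (auto simp: min_def field_simps)
  qed
  then obtain \<rho> where \<rho>: "\<And>n. 0 < \<rho> n" "\<And>n. 2 * (M n * \<rho> n) \<le> R n"
    "\<And>n. M (Suc n) * \<rho> (Suc n) \<le> \<rho> n" by blast
  define U where "U n = {y. infdist y (E n) < \<rho> n / 2}" for n
  have "open (U n)" for n
    unfolding U_def by (intro open_Collect_less continuous_intros)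
  moreover have "K \<subseteq> \<Union>(range U)"
  proof
    fix x assume "x \<in> K"
    then obtain j where "x \<in> E j" using cover by blast
    then have "x \<in> U j" using \<rho>(1)[of j] by (simp add: U_def)
    then show "x \<in> \<Union>(range U)" by blast
  qed
  ultimately obtain T where T: "T \<subseteq> range U" "finite T" "K \<subseteq> \<Union>T"
    using compactE[OF K, of "range U"] by (metis rangeE)
  obtain J where J: "finite J" "T = U ` J" using finite_subset_image[OF T(2,1)] by auto
  obtain m where m: "J \<subseteq> {..<m}" using J(1) finite_nat_bounded by blast
  define Z where "Z n = {z\<in>K. \<forall>k<n. \<rho> k / 2 \<le> infdist z (E k)}" for n
  define q where "q n = 2 * e * (M n * \<rho> n)" for n
  \<comment> \<open>Points near an earlier piece are left to later stages of the downward induction; at stage \<open>m\<close> no point remains.\<close>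
  have "\<exists>G r. continuous_on UNIV G \<and> 0 < r
      \<and> locally_fits H f B G (Z n) r (q n) (c + 6 * e * \<Lambda> * (1/2)^n)" if "n \<le> m" for n
    using that
  proof (induction n rule: inc_induct)
    case base
    have "Z m = {}"
    proof -
      have "\<exists>k<m. z \<in> U k" if "z \<in> K" for z using that T(3) J m by auto
      then show ?thesis by (auto simp: Z_def U_def not_le[symmetric])
    qed
    then show ?case
      by (intro exI[of _ "\<lambda>_. 0"] exI[of _ 1]) (auto simp: locally_fits_def)
  next
    case (step n)
    then obtain G r' where G: "continuous_on UNIV G" "0 < r'"
      "locally_fits H f B G (Z (Suc n)) r' (q (Suc n)) (c + 6 * e * \<Lambda> * (1/2)^Suc n)" by blast
    have \<Lambda>0: "0 \<le> \<Lambda>"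
    proof -
      obtain b :: 'b where "b \<in> Basis" using nonempty_Basis by blast
      then show ?thesis using order_trans[OF norm_ge_zero \<Lambda>[of b]] by simp
    qed
    have Zeq: "Z (Suc n) = {z \<in> Z n. \<rho> n / 2 \<le> infdist z (E n)}"
      by (auto simp: Z_def less_Suc_eq)
    define G' where "G' y = log_cutoff (\<kappa> n) (\<rho> n) (infdist y (E n)) * A n y
        + (1 - log_cutoff (\<kappa> n) (\<rho> n) (infdist y (E n))) * G y" for y
    have "\<exists>r>0. locally_fits H f B G' (Z n) r (2 * e * (exp (1 / \<kappa> n) * \<rho> n))
        ((c + 6 * e * \<Lambda> * (1/2)^Suc n) + 6 * e * \<Lambda> * \<kappa> n)"
      unfolding G'_def
    proof (rule blend_step)
      show "locally_fits H f B G {z \<in> Z n. \<rho> n / 2 \<le> infdist z (E n)} r' (q (Suc n))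
          (c + 6 * e * \<Lambda> * (1/2)^Suc n)" using G(3) Zeq by simp
      show "q (Suc n) \<le> 2 * e * \<rho> n"
        unfolding q_def using \<rho>(3)[of n] e by (intro mult_left_mono) auto
      show "2 * (exp (1 / \<kappa> n) * \<rho> n) \<le> R n" using \<rho>(2)[of n] by (simp add: M_def)
      show "c \<le> c + 6 * e * \<Lambda> * (1/2)^Suc n" using e \<Lambda>0 by simp
    qed (use e \<Lambda> \<rho>(1) \<kappa> A1 A2 G(2) in \<open>auto simp: Z_def\<close>)
    moreover have "(c + 6 * e * \<Lambda> * (1/2)^Suc n) + 6 * e * \<Lambda> * \<kappa> n = c + 6 * e * \<Lambda> * (1/2)^n"
      by (simp add: \<kappa>_def algebra_simps)
    moreover have "continuous_on UNIV G'"
      unfolding G'_def by (intro continuous_intros G(1) A3 \<rho>(1))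
    ultimately show ?case unfolding q_def M_def by metis
  qed
  from this[of 0] show ?thesis using that by (auto simp: Z_def)
qed

text \<open>The function \<open>H x - p \<bullet> x\<close> is \<open>e\<close>-Lipschitz on \<open>E\<close>, since the first order estimate holds with the same \<open>p\<close> at all
points of \<open>E\<close> and the diameter of \<open>E\<close> does not exceed its range. Add the linear form
back to the McShane extension of this Lipschitz function.\<close>
lemma nearly_affine_extension:
  fixes H :: "'a::euclidean_space \<Rightarrow> real"
  assumes e: "0 \<le> e" and E: "E \<noteq> {}" and R: "0 < R"
    and diam: "\<And>x x'. x \<in> E \<Longrightarrow> x' \<in> E \<Longrightarrow> dist x' x < R"
    and H: "\<And>x y. x \<in> E \<Longrightarrow> dist y x < R \<Longrightarrow> \<bar>H y - H x - p \<bullet> (y - x)\<bar> \<le> e * dist y x"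
  obtains A where "\<And>y y'. \<bar>A y' - A y - p \<bullet> (y' - y)\<bar> \<le> e * dist y' y"
    "\<And>y. infdist y E < R \<Longrightarrow> \<bar>A y - H y\<bar> \<le> 2 * e * infdist y E"
proof -
  define h where "h x = H x - p \<bullet> x" for x
  define L where "L y = (INF x\<in>E. h x + e * dist y x)" for y
  have hE: "h x \<le> h x' + e * dist x x'" if "x \<in> E" "x' \<in> E" for x x'
    using H[OF that(2), of x] diam[of x' x] that by (simp add: h_def inner_diff_right)
  have bdd: "bdd_below ((\<lambda>x. h x + e * dist y x) ` E)" for y
  proof -
    obtain x0 where x0: "x0 \<in> E" using E by blast
    have "h x0 - e * dist x0 y \<le> h x + e * dist y x" if "x \<in> E" for x
    proof -
      have "h x0 \<le> h x + e * (dist x0 y + dist y x)"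
        using hE[OF x0 that] mult_left_mono[OF dist_triangle[of x0 x y] e] by linarith
      then show ?thesis by (simp add: algebra_simps)
    qed
    then show ?thesis by (intro bdd_belowI2) auto
  qed
  have L1: "L y' \<le> L y + e * dist y' y" for y y'
  proof -
    have "L y' - e * dist y' y \<le> h x + e * dist y x" if "x \<in> E" for x
    proof -
      have "L y' \<le> h x + e * dist y' x"
        unfolding L_def by (rule cINF_lower[OF bdd that])
      also have "\<dots> \<le> h x + e * (dist y' y + dist y x)"
        using e by (intro add_left_mono mult_left_mono dist_triangle)
      finally show ?thesis by (simp add: algebra_simps)
    qed
    then have "L y' - e * dist y' y \<le> L y"
      unfolding L_def by (rule cINF_greatest[OF E])
    then show ?thesis by simp
  qed
  have L2: "L x = h x" if "x \<in> E" for x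
  proof (rule antisym)
    show "L x \<le> h x" unfolding L_def using cINF_lower[OF bdd that, of x] by simp
    show "h x \<le> L x" unfolding L_def by (rule cINF_greatest[OF E]) (rule hE[OF that])
  qed
  define A where "A y = p \<bullet> y + L y" for y
  have A1: "\<bar>A y' - A y - p \<bullet> (y' - y)\<bar> \<le> e * dist y' y" for y y'
    using L1[of y' y] L1[of y y'] by (simp add: A_def inner_diff_right dist_commute)
  moreover have "\<bar>A y - H y\<bar> \<le> 2 * e * infdist y E" if y: "infdist y E < R" for y
  proof -
    have *: "\<bar>A y - H y\<bar> \<le> 2 * e * t" if t: "infdist y E < t" "t < R" for t
    proof -
      have "\<exists>x\<in>E. dist y x < t" using t E
        by (simp add: infdist_def cINF_less_iff)
      then obtain x where x: "x \<in> E" "dist y x < t" by blast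
      have "A x = H x" using L2[OF x(1)] by (simp add: A_def h_def)
      then have "\<bar>A y - H y\<bar> \<le> 2 * e * dist y x"
        using A1[of y x] H[OF x(1), of y] x(2) t(2) by linarith
      also have "\<dots> \<le> 2 * e * t" using x e by (intro mult_left_mono) auto
      finally show ?thesis .
    qed
    show ?thesis
    proof (rule tendsto_lowerbound)
      show "((\<lambda>t. 2 * e * t) \<longlongrightarrow> 2 * e * infdist y E) (at_right (infdist y E))"
        by (intro tendsto_intros)
      show "\<forall>\<^sub>F t in at_right (infdist y E). \<bar>A y - H y\<bar> \<le> 2 * e * t"
        using eventually_at_right_real[OF y] by eventually_elim (use * in auto)
    qed simp
  qed
  ultimately show ?thesis using that by blast
qed

text \<open>The pieces are indexed by a slope \<open>p\<close> and a centre \<open>a\<close> from a countable dense set and by a scale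
\<open>1 / (n + 1)\<close>; differentiability of \<open>H\<close> puts every point of \<open>K\<close> into one of them. Recording
\<open>norm (g x - p) \<le> e\<close> and keeping the scale below the modulus of continuity of \<open>f\<close> makes \<open>p\<close> represent \<open>f\<close>
near the whole piece.\<close>
theorem local_approximation_of_differentiable:
  fixes H :: "'a::euclidean_space \<Rightarrow> real" and f :: "'a \<Rightarrow> 'b::euclidean_space"
    and B :: "'b \<Rightarrow> 'a"
  assumes K: "compact K" and H: "\<And>x. x \<in> K \<Longrightarrow> GDERIV H x :> g x"
    and fB: "\<And>x w. x \<in> K \<Longrightarrow> f x \<bullet> w = g x \<bullet> B w" and f: "continuous_on K f"
    and \<Lambda>: "\<And>w. norm (B w) \<le> \<Lambda> * norm w" and e: "0 < e"
  obtains G r q where "continuous_on UNIV G" "0 < r"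
    "locally_fits H f B G K r q ((8 * \<Lambda> + 1) * e)"
proof (cases "K = {}")
  case True
  then show ?thesis using that[of "\<lambda>_. 0" 1 0] by (simp add: locally_fits_def)
next
  case False
  obtain \<delta> where \<delta>: "0 < \<delta>" "\<And>x z. x \<in> K \<Longrightarrow> z \<in> K \<Longrightarrow> dist z x < \<delta> \<Longrightarrow> dist (f z) (f x) < e"
    using compact_uniformly_continuous[OF f K] e unfolding uniformly_continuous_on_def by metis
  obtain D :: "'a set" where D: "countable D" "\<And>X. open X \<Longrightarrow> X \<noteq> {} \<Longrightarrow> \<exists>d\<in>D. d \<in> X"
    using countable_dense_exists by blast
  define Rn where "Rn n = 1 / real (Suc n)" for n
  define P where "P = (\<lambda>(p, a, n). {x\<in>K. dist x a < Rn n / 2 \<and> norm (g x - p) \<le> e \<and>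
      (\<forall>y. dist y x < Rn n \<longrightarrow> \<bar>H y - H x - p \<bullet> (y - x)\<bar> \<le> e * dist y x)})"
  \<comment> \<open>Empty pieces are discarded because the distance to the empty set is 0 by convention.\<close>
  define T where "T = {t \<in> D \<times> D \<times> {n. Rn n < \<delta>}. P t \<noteq> {}}"
  have "countable T" unfolding T_def using D(1) by (auto intro!: countable_Collect)
  have cover: "\<exists>t\<in>T. x \<in> P t" if x: "x \<in> K" for x
  proof -
    obtain p where p: "p \<in> D" "dist (g x) p < e / 2"
      using D(2)[of "ball (g x) (e/2)"] e by (auto simp: dist_commute)
    have "(H has_derivative (\<lambda>h. h \<bullet> g x)) (at x)"
      using H[OF x] by (simp add: gderiv_def)
    then obtain d where d: "0 < d" "\<And>y. norm (y - x) < d \<Longrightarrow>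
        norm (H y - H x - (y - x) \<bullet> g x) \<le> e / 2 * norm (y - x)"
      unfolding has_derivative_at_alt using e by (meson half_gt_zero)
    obtain n where n: "1 / real (Suc n) < min d \<delta>"
      using nat_approx_posE[of "min d \<delta>"] d(1) \<delta>(1) by (metis min_less_iff_conj)
    have Rn: "0 < Rn n" by (simp add: Rn_def)
    obtain a where a: "a \<in> D" "dist x a < Rn n / 2"
      using D(2)[of "ball x (Rn n / 2)"] Rn by (auto simp: dist_commute)
    have "\<bar>H y - H x - p \<bullet> (y - x)\<bar> \<le> e * dist y x" if "dist y x < Rn n" for y
    proof -
      have 1: "\<bar>H y - H x - g x \<bullet> (y - x)\<bar> \<le> e / 2 * norm (y - x)"
        using d(2)[of y] that n by (simp add: Rn_def dist_norm inner_commute)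
      have "\<bar>(g x - p) \<bullet> (y - x)\<bar> \<le> norm (g x - p) * norm (y - x)"
        by (rule Cauchy_Schwarz_ineq2)
      also have "\<dots> \<le> e / 2 * norm (y - x)"
        using p(2) by (intro mult_right_mono) (auto simp: dist_norm)
      finally show ?thesis using 1
        unfolding dist_norm inner_diff_left by argo
    qed
    then have "x \<in> P (p, a, n)"
      using x a p e by (auto simp: P_def dist_norm)
    moreover have "(p, a, n) \<in> T" using p(1) a(1) n \<open>x \<in> P (p, a, n)\<close>
      by (auto simp: T_def Rn_def)
    ultimately show ?thesis by blast
  qed
  then have "T \<noteq> {}" using False by blast
  define t where "t = from_nat_into T"
  have tT: "t j \<in> T" for j using from_nat_into[OF \<open>T \<noteq> {}\<close>] by (simp add: t_def)
  define E where "E j = P (t j)" for j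
  define R where "R j = Rn (snd (snd (t j)))" for j
  define p where "p j = fst (t j)" for j
  have R: "0 < R j" "R j < \<delta>" "E j \<noteq> {}" "E j \<subseteq> K" for j
    using tT[of j] by (auto simp: T_def R_def E_def P_def Rn_def)
  have E: "dist x (fst (snd (t j))) < R j / 2" "norm (g x - p j) \<le> e"
    "\<And>y. dist y x < R j \<Longrightarrow> \<bar>H y - H x - p j \<bullet> (y - x)\<bar> \<le> e * dist y x" if "x \<in> E j" for x j
    using that by (auto simp: E_def P_def R_def p_def split: prod.splits)
  have "\<exists>A. (\<forall>y y'. \<bar>A y' - A y - p j \<bullet> (y' - y)\<bar> \<le> e * dist y' y) \<and>
    (\<forall>y. infdist y (E j) < R j \<longrightarrow> \<bar>A y - H y\<bar> \<le> 2 * e * infdist y (E j))" for j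
  proof -
    have "dist x' x < R j" if "x \<in> E j" "x' \<in> E j" for x x'
      using E(1)[OF that(1)] E(1)[OF that(2)] dist_triangle_half_l by blast
    with nearly_affine_extension[of e "E j" "R j" H "p j"] e R E(3) show ?thesis
      by (metis less_imp_le)
  qed
  then obtain A where A: "\<And>j y y'. \<bar>A j y' - A j y - p j \<bullet> (y' - y)\<bar> \<le> e * dist y' y"
    "\<And>j y. infdist y (E j) < R j \<Longrightarrow> \<bar>A j y - H y\<bar> \<le> 2 * e * infdist y (E j)" by metis
  have A_cont: "continuous_on UNIV (A j)" for j
  proof -
    have "(norm (p j) + e)-lipschitz_on UNIV (A j)"
    proof (rule lipschitz_onI)
      fix y' y
      have "\<bar>p j \<bullet> (y' - y)\<bar> \<le> norm (p j) * dist y' y"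
        using Cauchy_Schwarz_ineq2[of "p j" "y' - y"] by (simp add: dist_norm)
      then show "dist (A j y') (A j y) \<le> (norm (p j) + e) * dist y' y"
        using A(1)[of j y' y] by (simp add: dist_real_def algebra_simps)
    qed (use e in auto)
    then show ?thesis by (rule lipschitz_on_continuous_on)
  qed
  have difference: "\<bar>A j (y + B w) - A j y - f z \<bullet> w\<bar> \<le> ((2 * \<Lambda> + 1) * e) * norm w"
    if z: "z \<in> K" "infdist z (E j) < R j" for j z y w
  proof -
    have "\<exists>x\<in>E j. dist z x < R j"
      using z R(3)[of j] by (simp add: infdist_def cINF_less_iff)
    then obtain x where x: "x \<in> E j" "dist z x < R j" by blast
    have xK: "x \<in> K" using x R(4) by blast
    have 1: "\<bar>A j (y + B w) - A j y - p j \<bullet> B w\<bar> \<le> e * (\<Lambda> * norm w)"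
      using A(1)[where j=j and y'="y + B w" and y=y] mult_left_mono[OF \<Lambda>[of w] less_imp_le[OF e]]
      unfolding dist_norm add_diff_cancel_left' by linarith
    have "\<bar>(g x - p j) \<bullet> B w\<bar> \<le> norm (g x - p j) * norm (B w)"
      by (rule Cauchy_Schwarz_ineq2)
    also have "\<dots> \<le> e * (\<Lambda> * norm w)"
      using E(2)[OF x(1)] \<Lambda>[of w] e by (intro mult_mono) auto
    finally have 2: "\<bar>f x \<bullet> w - p j \<bullet> B w\<bar> \<le> e * (\<Lambda> * norm w)"
      using fB[OF xK, of w] by (simp add: inner_diff_left)
    have "\<bar>(f z - f x) \<bullet> w\<bar> \<le> norm (f z - f x) * norm w" by (rule Cauchy_Schwarz_ineq2)
    also have "\<dots> \<le> e * norm w"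
      using \<delta>(2)[OF xK z(1)] x(2) R(2)[of j] by (intro mult_right_mono) (auto simp: dist_norm)
    finally have "\<bar>f z \<bullet> w - f x \<bullet> w\<bar> \<le> e * norm w" by (simp add: inner_diff_left)
    then show ?thesis using 1 2 by (simp add: algebra_simps)
  qed
  have cover_E: "K \<subseteq> (\<Union>j. E j)"
  proof
    fix x assume "x \<in> K"
    then obtain s where "s \<in> T" "x \<in> P s" using cover by blast
    moreover obtain j where "t j = s"
      using from_nat_into_surj[OF \<open>countable T\<close> \<open>s \<in> T\<close>] by (auto simp: t_def)
    ultimately show "x \<in> (\<Union>j. E j)" by (auto simp: E_def)
  qed
  show ?thesis
  proof (rule blend_countable_cover[where f = f and H = H and c = "(2 * \<Lambda> + 1) * e",
        OF K e \<Lambda> R(1) cover_E A(2) difference A_cont])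
    fix G r q
    assume "continuous_on UNIV G" "0 < r"
      "locally_fits H f B G K r q ((2 * \<Lambda> + 1) * e + 6 * e * \<Lambda>)"
    then show ?thesis using that[of G r q] by (simp add: algebra_simps)
  qed
qed

section \<open>Approximation by networks together with the gradient\<close>

text \<open>Networks are generated together with their formal gradients, so that both can be approximated at once;
\<open>\<sigma>'\<close> stands for the derivative of \<open>\<sigma>\<close>.\<close>
inductive ridge_sum ::
  "(real \<Rightarrow> real) \<Rightarrow> (real \<Rightarrow> real) \<Rightarrow> ('a::euclidean_space \<Rightarrow> real) \<Rightarrow> ('a \<Rightarrow> 'a) \<Rightarrow> bool"
  for \<sigma> \<sigma>' :: "real \<Rightarrow> real" where
  neuron: "ridge_sum \<sigma> \<sigma>' (\<lambda>x. \<beta> * \<sigma> (a \<bullet> x + b)) (\<lambda>x. (\<beta> * \<sigma>' (a \<bullet> x + b)) *\<^sub>R a)"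
| add: "ridge_sum \<sigma> \<sigma>' n n' \<Longrightarrow> ridge_sum \<sigma> \<sigma>' m m' \<Longrightarrow>
    ridge_sum \<sigma> \<sigma>' (\<lambda>x. n x + m x) (\<lambda>x. n' x + m' x)"

lemma ridge_sum_scale:
  "ridge_sum \<sigma> \<sigma>' n n' \<Longrightarrow> ridge_sum \<sigma> \<sigma>' (\<lambda>x. c * n x) (\<lambda>x. c *\<^sub>R n' x)"
proof (induction rule: ridge_sum.induct)
  case (neuron \<beta> a b)
  then show ?case using ridge_sum.neuron[of \<sigma> \<sigma>' "c * \<beta>" a b] by (simp add: mult.assoc)
next
  case (add n n' m m')
  then show ?case using ridge_sum.add[OF add.IH] by (simp add: algebra_simps)
qed

lemma ridge_sum_ridge:
  assumes "ridge_sum \<sigma> \<sigma>' (n :: real \<Rightarrow> real) n'"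
  shows "ridge_sum \<sigma> \<sigma>' (\<lambda>x. n (a \<bullet> x + b)) (\<lambda>x. n' (a \<bullet> x + b) *\<^sub>R a)"
  using assms
proof (induction rule: ridge_sum.induct)
  case (neuron \<beta> c d)
  then show ?case using ridge_sum.neuron[of \<sigma> \<sigma>' \<beta> "c *\<^sub>R a" "c * b + d"]
    by (simp add: algebra_simps)
next
  case (add n n' m m')
  then show ?case using ridge_sum.add[OF add.IH] by (simp add: algebra_simps)
qed

lemma ridge_sum_GDERIV:
  assumes "ridge_sum \<sigma> \<sigma>' n n'" and "\<And>t. DERIV \<sigma> t :> \<sigma>' t"
  shows "GDERIV n x :> n' x"
  using assms(1)
proof (induction rule: ridge_sum.induct)
  case (neuron \<beta> a b)
  have "GDERIV (\<lambda>x. a \<bullet> x + b) x :> a"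
    unfolding gderiv_def by (auto intro!: derivative_eq_intros simp: inner_commute)
  moreover have "DERIV (\<lambda>t. \<beta> * \<sigma> t) (a \<bullet> x + b) :> \<beta> * \<sigma>' (a \<bullet> x + b)"
    by (intro DERIV_cmult assms)
  ultimately show ?case by (rule GDERIV_DERIV_compose)
next
  case (add n n' m m')
  then show ?case by (intro GDERIV_add)
qed

lemma ridge_sum_continuous_gradient:
  assumes "ridge_sum \<sigma> \<sigma>' n n'" and "continuous_on UNIV \<sigma>'"
  shows "continuous_on UNIV n'"
  using assms(1)
proof (induction rule: ridge_sum.induct)
  case (neuron \<beta> a b)
  show ?case by (intro continuous_intros continuous_on_compose2[OF assms(2)]) auto
next
  case (add n n' m m')
  then show ?case by (intro continuous_intros)
qed

text \<open>The gradient is an argument of its own, so that limits can be taken in both components separately.\<close>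
definition C1_approx ::
  "(real \<Rightarrow> real) \<Rightarrow> (real \<Rightarrow> real) \<Rightarrow> 'a::euclidean_space set \<Rightarrow> ('a \<Rightarrow> real) \<Rightarrow> ('a \<Rightarrow> 'a) \<Rightarrow> bool" where
  "C1_approx \<sigma> \<sigma>' K g g' \<longleftrightarrow> (\<forall>\<delta>>0. \<exists>n n'. ridge_sum \<sigma> \<sigma>' n n' \<and>
     (\<forall>x\<in>K. \<bar>n x - g x\<bar> \<le> \<delta> \<and> norm (n' x - g' x) \<le> \<delta>))"

lemma C1_approxD:
  assumes "C1_approx \<sigma> \<sigma>' K g g'" "0 < \<delta>"
  obtains n n' where "ridge_sum \<sigma> \<sigma>' n n'"
    "\<And>x. x \<in> K \<Longrightarrow> \<bar>n x - g x\<bar> \<le> \<delta>" "\<And>x. x \<in> K \<Longrightarrow> norm (n' x - g' x) \<le> \<delta>"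
  using assms unfolding C1_approx_def by blast

lemma C1_approx_ridge_sum: "ridge_sum \<sigma> \<sigma>' n n' \<Longrightarrow> C1_approx \<sigma> \<sigma>' K n n'"
  unfolding C1_approx_def by (intro allI impI exI[of _ n] exI[of _ n']) auto

lemma C1_approx_closed:
  assumes "\<And>\<delta>. 0 < \<delta> \<Longrightarrow> \<exists>h h'. C1_approx \<sigma> \<sigma>' K h h' \<and>
     (\<forall>x\<in>K. \<bar>h x - g x\<bar> \<le> \<delta> \<and> norm (h' x - g' x) \<le> \<delta>)"
  shows "C1_approx \<sigma> \<sigma>' K g g'"
  unfolding C1_approx_def
proof (intro allI impI)
  fix \<delta> :: real assume "0 < \<delta>"
  then have d: "0 < \<delta> / 2" by simp
  obtain h h' where h: "C1_approx \<sigma> \<sigma>' K h h'"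
    "\<And>x. x \<in> K \<Longrightarrow> \<bar>h x - g x\<bar> \<le> \<delta> / 2" "\<And>x. x \<in> K \<Longrightarrow> norm (h' x - g' x) \<le> \<delta> / 2"
    using assms[OF d] by blast
  obtain n n' where n: "ridge_sum \<sigma> \<sigma>' n n'"
    "\<And>x. x \<in> K \<Longrightarrow> \<bar>n x - h x\<bar> \<le> \<delta> / 2" "\<And>x. x \<in> K \<Longrightarrow> norm (n' x - h' x) \<le> \<delta> / 2"
    using C1_approxD[OF h(1) d] by blast
  have "\<bar>n x - g x\<bar> \<le> \<delta> \<and> norm (n' x - g' x) \<le> \<delta>" if "x \<in> K" for x
  proof
    show "\<bar>n x - g x\<bar> \<le> \<delta>" using h(2)[OF that] n(2)[OF that] by linarith
    show "norm (n' x - g' x) \<le> \<delta>"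
      using norm_diff_triangle_le[OF n(3)[OF that] h(3)[OF that]] by simp
  qed
  then show "\<exists>n n'. ridge_sum \<sigma> \<sigma>' n n' \<and> (\<forall>x\<in>K. \<bar>n x - g x\<bar> \<le> \<delta> \<and> norm (n' x - g' x) \<le> \<delta>)"
    using n(1) by blast
qed

lemma C1_approx_add:
  assumes "C1_approx \<sigma> \<sigma>' K g g'" "C1_approx \<sigma> \<sigma>' K h h'"
  shows "C1_approx \<sigma> \<sigma>' K (\<lambda>x. g x + h x) (\<lambda>x. g' x + h' x)"
  unfolding C1_approx_def
proof (intro allI impI)
  fix \<delta> :: real assume "0 < \<delta>"
  then have d: "0 < \<delta> / 2" by simp
  obtain n n' where n: "ridge_sum \<sigma> \<sigma>' n n'"
    "\<And>x. x \<in> K \<Longrightarrow> \<bar>n x - g x\<bar> \<le> \<delta> / 2" "\<And>x. x \<in> K \<Longrightarrow> norm (n' x - g' x) \<le> \<delta> / 2"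
    using C1_approxD[OF assms(1) d] by blast
  obtain m m' where m: "ridge_sum \<sigma> \<sigma>' m m'"
    "\<And>x. x \<in> K \<Longrightarrow> \<bar>m x - h x\<bar> \<le> \<delta> / 2" "\<And>x. x \<in> K \<Longrightarrow> norm (m' x - h' x) \<le> \<delta> / 2"
    using C1_approxD[OF assms(2) d] by blast
  have "\<bar>n x + m x - (g x + h x)\<bar> \<le> \<delta> \<and> norm (n' x + m' x - (g' x + h' x)) \<le> \<delta>"
    if "x \<in> K" for x
  proof
    show "\<bar>n x + m x - (g x + h x)\<bar> \<le> \<delta>" using n(2)[OF that] m(2)[OF that] by linarith
    show "norm (n' x + m' x - (g' x + h' x)) \<le> \<delta>"
      using norm_diff_triangle_ineq[of "n' x" "m' x" "g' x" "h' x"] n(3)[OF that] m(3)[OF that]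
      by linarith
  qed
  then show "\<exists>k k'. ridge_sum \<sigma> \<sigma>' k k' \<and>
      (\<forall>x\<in>K. \<bar>k x - (g x + h x)\<bar> \<le> \<delta> \<and> norm (k' x - (g' x + h' x)) \<le> \<delta>)"
    using ridge_sum.add[OF n(1) m(1)] by blast
qed

lemma C1_approx_scale:
  assumes "C1_approx \<sigma> \<sigma>' K g g'"
  shows "C1_approx \<sigma> \<sigma>' K (\<lambda>x. c * g x) (\<lambda>x. c *\<^sub>R g' x)"
  unfolding C1_approx_def
proof (intro allI impI)
  fix \<delta> :: real assume \<delta>: "0 < \<delta>"
  define \<eta> where "\<eta> = \<delta> / (\<bar>c\<bar> + 1)"
  have \<eta>: "0 < \<eta>" using \<delta> by (simp add: \<eta>_def)
  have c\<eta>: "\<bar>c\<bar> * \<eta> \<le> \<delta>" using \<delta> by (simp add: \<eta>_def field_simps)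
  obtain n n' where n: "ridge_sum \<sigma> \<sigma>' n n'"
    "\<And>x. x \<in> K \<Longrightarrow> \<bar>n x - g x\<bar> \<le> \<eta>" "\<And>x. x \<in> K \<Longrightarrow> norm (n' x - g' x) \<le> \<eta>"
    using C1_approxD[OF assms \<eta>] by blast
  have "\<bar>c * n x - c * g x\<bar> \<le> \<delta> \<and> norm (c *\<^sub>R n' x - c *\<^sub>R g' x) \<le> \<delta>" if "x \<in> K" for x
    using mult_left_mono[OF n(2)[OF that], of "\<bar>c\<bar>"] mult_left_mono[OF n(3)[OF that], of "\<bar>c\<bar>"] c\<eta>
    by (simp add: abs_mult[symmetric] algebra_simps flip: scaleR_diff_right)
  then show "\<exists>k k'. ridge_sum \<sigma> \<sigma>' k k' \<and>
      (\<forall>x\<in>K. \<bar>k x - c * g x\<bar> \<le> \<delta> \<and> norm (k' x - c *\<^sub>R g' x) \<le> \<delta>)"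
    using ridge_sum_scale[OF n(1)] by blast
qed

lemma C1_approx_zero: "C1_approx \<sigma> \<sigma>' K (\<lambda>x. 0) (\<lambda>x. 0)"
  using C1_approx_ridge_sum[OF ridge_sum.neuron[of \<sigma> \<sigma>' 0 0 0]] by simp

lemma C1_approx_sum:
  assumes "\<And>i. i \<in> I \<Longrightarrow> C1_approx \<sigma> \<sigma>' K (g i) (g' i)"
  shows "C1_approx \<sigma> \<sigma>' K (\<lambda>x. \<Sum>i\<in>I. g i x) (\<lambda>x. \<Sum>i\<in>I. g' i x)"
  using assms
  by (induction I rule: infinite_finite_induct) (auto intro: C1_approx_zero C1_approx_add)

text \<open>Composing with an affine form turns a network in one variable into a network in several variables.\<close>
lemma C1_approx_ridge:
  fixes K :: "'a::euclidean_space set"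
  assumes "C1_approx \<sigma> \<sigma>' X g g'" and X: "\<And>x. x \<in> K \<Longrightarrow> a \<bullet> x + b \<in> X"
  shows "C1_approx \<sigma> \<sigma>' K (\<lambda>x. g (a \<bullet> x + b)) (\<lambda>x. g' (a \<bullet> x + b) *\<^sub>R a)"
  unfolding C1_approx_def
proof (intro allI impI)
  fix \<delta> :: real assume \<delta>: "0 < \<delta>"
  define \<eta> where "\<eta> = \<delta> / (norm a + 1)"
  have \<eta>: "0 < \<eta>" "\<eta> \<le> \<delta>" "\<eta> * norm a \<le> \<delta>"
    using \<delta> by (auto simp: \<eta>_def field_simps add_pos_nonneg intro: add_nonneg_pos)
  obtain n n' where n: "ridge_sum \<sigma> \<sigma>' n n'"
    "\<And>x. x \<in> X \<Longrightarrow> \<bar>n x - g x\<bar> \<le> \<eta>" "\<And>x. x \<in> X \<Longrightarrow> norm (n' x - g' x) \<le> \<eta>"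
    using C1_approxD[OF assms(1) \<eta>(1)] by blast
  have "\<bar>n (a \<bullet> x + b) - g (a \<bullet> x + b)\<bar> \<le> \<delta> \<and>
      norm (n' (a \<bullet> x + b) *\<^sub>R a - g' (a \<bullet> x + b) *\<^sub>R a) \<le> \<delta>" if "x \<in> K" for x
    using n(2)[OF X[OF that]] mult_right_mono[OF n(3)[OF X[OF that]], of "norm a"] \<eta>
    by (simp flip: scaleR_diff_left)
  then show "\<exists>k k'. ridge_sum \<sigma> \<sigma>' k k' \<and> (\<forall>x\<in>K. \<bar>k x - g (a \<bullet> x + b)\<bar> \<le> \<delta> \<and>
      norm (k' x - g' (a \<bullet> x + b) *\<^sub>R a) \<le> \<delta>)"
    using ridge_sum_ridge[OF n(1)] by blast
qed

section \<open>Integrals, parameter derivatives and polynomials\<close>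

lemma continuous_on_slice:
  assumes "continuous_on (K \<times> Z) (\<lambda>(x, z). F x z)" "x \<in> K"
  shows "continuous_on Z (F x)"
proof -
  have "continuous_on Z (\<lambda>z. (x, z))" by (intro continuous_intros)
  from continuous_on_compose2[OF assms(1) this] show ?thesis using assms(2) by force
qed

text \<open>By uniform continuity on \<open>K \<times> cbox a b\<close>, one sufficiently fine tagged division serves all \<open>x\<close> in \<open>K\<close>.\<close>
lemma uniform_Riemann_sums:
  fixes F :: "'x::metric_space \<Rightarrow> 'z::euclidean_space \<Rightarrow> 'c::banach"
  assumes K: "compact K" and F: "continuous_on (K \<times> cbox a b) (\<lambda>(x, z). F x z)" and \<delta>: "0 < \<delta>"
  obtains p :: "('z \<times> 'z set) set" where
    "\<And>i. i \<in> p \<Longrightarrow> fst i \<in> cbox a b"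
    "\<And>x. x \<in> K \<Longrightarrow>
      norm ((\<Sum>i\<in>p. measure lborel (snd i) *\<^sub>R F x (fst i)) - integral (cbox a b) (F x)) \<le> \<delta>"
proof -
  define C where "C = measure lborel (cbox a b)"
  define \<eta> where "\<eta> = \<delta> / (C + 1)"
  have C: "0 \<le> C" by (simp add: C_def)
  have \<eta>: "0 < \<eta>" "\<eta> * C \<le> \<delta>" using \<delta> C by (auto simp: \<eta>_def field_simps)
  obtain d where d: "0 < d" "\<And>u v. u \<in> K \<times> cbox a b \<Longrightarrow> v \<in> K \<times> cbox a b \<Longrightarrow> dist v u < d \<Longrightarrow>
      dist ((\<lambda>(x, z). F x z) v) ((\<lambda>(x, z). F x z) u) < \<eta>"
    using compact_uniformly_continuous[OF F compact_Times[OF K compact_cbox]] \<eta>(1)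
    unfolding uniformly_continuous_on_def by metis
  obtain p where p: "p tagged_division_of cbox a b" "(\<lambda>x. ball x d) fine p"
    using fine_division_exists[OF gauge_ball[OF d(1)]] by metis
  have cF: "continuous_on (cbox a b) (F x)" if "x \<in> K" for x
    by (rule continuous_on_slice[OF F that])
  have "norm ((\<Sum>i\<in>p. measure lborel (snd i) *\<^sub>R F x (fst i)) - integral (cbox a b) (F x)) \<le> \<delta>"
    if x: "x \<in> K" for x
  proof -
    have piece: "norm (measure lborel (snd i) *\<^sub>R F x (fst i) - integral (snd i) (F x))
        \<le> \<eta> * measure lborel (snd i)" if i: "i \<in> p" for i
    proof -
      obtain t k where tk: "i = (t, k)" by fastforce
      note t = tagged_division_ofD(2-4)[OF p(1) i[unfolded tk]]
      obtain u v where uv: "k = cbox u v" using t(3) by blast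
      have "F x integrable_on k"
        unfolding uv by (rule integrable_continuous[OF continuous_on_subset[OF cF[OF x]]])
          (use t uv in auto)
      then have "((\<lambda>z. F x z - F x t) has_integral (integral k (F x) - measure lborel k *\<^sub>R F x t)) (cbox u v)"
        unfolding uv by (intro has_integral_diff integrable_integral has_integral_const)
      moreover have "norm (F x z - F x t) \<le> \<eta>" if "z \<in> cbox u v" for z
      proof -
        have "z \<in> ball t d" using p(2) i tk that uv unfolding fine_def by blast
        then show ?thesis
          using d(2)[of "(x, t)" "(x, z)"] x t that uv
          by (simp add: dist_Pair_Pair dist_commute subset_eq) (simp add: dist_norm norm_minus_commute)
      qed
      ultimately have "norm (integral k (F x) - measure lborel k *\<^sub>R F x t) \<le> \<eta> * measure lborel (cbox u v)"
        using has_integral_bound[of \<eta>] \<eta>(1) by (metis less_imp_le)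
      then show ?thesis using uv tk by (simp add: norm_minus_commute)
    qed
    have "integral (cbox a b) (F x) = (\<Sum>i\<in>p. integral (snd i) (F x))"
      using integral_combine_tagged_division_topdown[OF integrable_continuous[OF cF[OF x]] p(1)]
      by (simp add: case_prod_unfold)
    then have "norm ((\<Sum>i\<in>p. measure lborel (snd i) *\<^sub>R F x (fst i)) - integral (cbox a b) (F x))
        = norm (\<Sum>i\<in>p. measure lborel (snd i) *\<^sub>R F x (fst i) - integral (snd i) (F x))"
      by (simp add: sum_subtractf)
    also have "\<dots> \<le> (\<Sum>i\<in>p. \<eta> * measure lborel (snd i))" by (intro sum_norm_le piece)
    also have "\<dots> = \<eta> * C"
      using additive_content_tagged_division[OF p(1)]
      by (simp add: C_def case_prod_unfold flip: sum_distrib_left)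
    finally show ?thesis using \<eta>(2) by linarith
  qed
  moreover have "fst i \<in> cbox a b" if "i \<in> p" for i
    using tagged_division_ofD(2,3)[OF p(1), of "fst i" "snd i"] that by auto
  ultimately show ?thesis using that by blast
qed

text \<open>The function and its gradient are paired so that the same Riemann sum approximates both.\<close>
lemma C1_approx_integral:
  fixes F :: "'a::euclidean_space \<Rightarrow> 'z::euclidean_space \<Rightarrow> real"
  assumes K: "compact K" and F: "continuous_on (K \<times> cbox a b) (\<lambda>(x, z). F x z)"
    and F': "continuous_on (K \<times> cbox a b) (\<lambda>(x, z). F' x z)"
    and approx: "\<And>z. z \<in> cbox a b \<Longrightarrow> C1_approx \<sigma> \<sigma>' K (\<lambda>x. F x z) (\<lambda>x. F' x z)"
  shows "C1_approx \<sigma> \<sigma>' K (\<lambda>x. integral (cbox a b) (F x)) (\<lambda>x. integral (cbox a b) (F' x))"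
proof (rule C1_approx_closed)
  fix \<delta> :: real assume \<delta>: "0 < \<delta>"
  define P where "P x z = (F x z, F' x z)" for x z
  have P: "continuous_on (K \<times> cbox a b) (\<lambda>(x, z). P x z)"
    using continuous_on_Pair[OF F F'] by (simp add: P_def case_prod_unfold)
  obtain p :: "('z \<times> 'z set) set" where p: "\<And>i. i \<in> p \<Longrightarrow> fst i \<in> cbox a b"
    "\<And>x. x \<in> K \<Longrightarrow>
      norm ((\<Sum>i\<in>p. measure lborel (snd i) *\<^sub>R P x (fst i)) - integral (cbox a b) (P x)) \<le> \<delta>"
    using uniform_Riemann_sums[OF K P \<delta>] by blast
  have "\<bar>(\<Sum>i\<in>p. measure lborel (snd i) * F x (fst i)) - integral (cbox a b) (F x)\<bar> \<le> \<delta> \<and>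
      norm ((\<Sum>i\<in>p. measure lborel (snd i) *\<^sub>R F' x (fst i)) - integral (cbox a b) (F' x)) \<le> \<delta>"
    if x: "x \<in> K" for x
  proof -
    have "continuous_on (cbox a b) (P x)"
      by (rule continuous_on_slice[OF P x])
    then have int: "P x integrable_on cbox a b" by (rule integrable_continuous)
    have 1: "fst (integral (cbox a b) (P x)) = integral (cbox a b) (F x)"
      using integral_linear[OF int bounded_linear_fst] by (simp add: o_def P_def)
    have 2: "snd (integral (cbox a b) (P x)) = integral (cbox a b) (F' x)"
      using integral_linear[OF int bounded_linear_snd] by (simp add: o_def P_def)
    let ?D = "(\<Sum>i\<in>p. measure lborel (snd i) *\<^sub>R P x (fst i)) - integral (cbox a b) (P x)"
    have "norm (fst ?D) \<le> \<delta>" "norm (snd ?D) \<le> \<delta>"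
      using p(2)[OF x] norm_fst_le[of "fst ?D" "snd ?D"] norm_snd_le[of "snd ?D" "fst ?D"]
      unfolding prod.collapse by linarith+
    then show ?thesis by (simp add: 1 2 fst_sum snd_sum P_def)
  qed
  moreover have "C1_approx \<sigma> \<sigma>' K (\<lambda>x. \<Sum>i\<in>p. measure lborel (snd i) * F x (fst i))
      (\<lambda>x. \<Sum>i\<in>p. measure lborel (snd i) *\<^sub>R F' x (fst i))"
    by (intro C1_approx_sum C1_approx_scale approx p(1))
  ultimately show "\<exists>h h'. C1_approx \<sigma> \<sigma>' K h h' \<and> (\<forall>x\<in>K.
      \<bar>h x - integral (cbox a b) (F x)\<bar> \<le> \<delta> \<and> norm (h' x - integral (cbox a b) (F' x)) \<le> \<delta>)"
    by blast
qed

text \<open>The mean value theorem bounds the deviation by the oscillation of \<open>P\<close> over an interval of length \<open>h\<close>.\<close>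
lemma uniform_difference_quotient:
  fixes F :: "real \<Rightarrow> 'x::metric_space \<Rightarrow> 'c::real_normed_vector"
  assumes K: "compact K"
    and F: "\<And>s x. x \<in> K \<Longrightarrow> ((\<lambda>s. F s x) has_vector_derivative P s x) (at s)"
    and P: "continuous_on (UNIV \<times> K) (\<lambda>(s, x). P s x)" and \<delta>: "0 < \<delta>"
  obtains d where "0 < d"
    "\<And>h x. 0 < h \<Longrightarrow> h < d \<Longrightarrow> x \<in> K \<Longrightarrow> norm ((1 / h) *\<^sub>R (F (s + h) x - F s x) - P s x) \<le> \<delta>"
proof -
  define X where "X = {s .. s + 1} \<times> K"
  have "compact X" unfolding X_def by (intro compact_Times compact_Icc K)
  moreover have "continuous_on X (\<lambda>(s, x). P s x)"
    by (rule continuous_on_subset[OF P]) (auto simp: X_def)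
  ultimately obtain d where d: "0 < d" "\<And>u v. u \<in> X \<Longrightarrow> v \<in> X \<Longrightarrow> dist v u < d \<Longrightarrow>
      dist ((\<lambda>(s, x). P s x) v) ((\<lambda>(s, x). P s x) u) < \<delta>"
    using compact_uniformly_continuous[of X] \<delta> unfolding uniformly_continuous_on_def by metis
  have "norm ((1 / h) *\<^sub>R (F (s + h) x - F s x) - P s x) \<le> \<delta>"
    if h: "0 < h" "h < min d 1" and x: "x \<in> K" for h x
  proof -
    have "norm (F (s + h) x - F s x - (s + h - s) *\<^sub>R P s x) \<le> norm (s + h - s) * \<delta>"
    proof (rule vector_differentiable_bound_linearization[where S = "{s .. s + h}" and f' = "\<lambda>s. P s x"])
      show "((\<lambda>s. F s x) has_vector_derivative P t x) (at t within {s..s + h})" for t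
        by (rule has_vector_derivative_at_within[OF F[OF x]])
      show "closed_segment s (s + h) \<subseteq> {s..s + h}" using h by (simp add: closed_segment_eq_real_ivl)
      show "norm (P t x - P s x) \<le> \<delta>" if "t \<in> {s..s + h}" for t
        using d(2)[of "(s, x)" "(t, x)"] that h x
        by (auto simp: X_def dist_Pair_Pair dist_norm)
    qed (use h in auto)
    then have *: "norm (F (s + h) x - F s x - h *\<^sub>R P s x) \<le> h * \<delta>" using h by simp
    have "(1 / h) *\<^sub>R (F (s + h) x - F s x) - P s x = (1 / h) *\<^sub>R (F (s + h) x - F s x - h *\<^sub>R P s x)"
      using h by (simp add: algebra_simps)
    then have "norm ((1 / h) *\<^sub>R (F (s + h) x - F s x) - P s x)
        = (1 / h) * norm (F (s + h) x - F s x - h *\<^sub>R P s x)" using h by simp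
    also have "\<dots> \<le> (1 / h) * (h * \<delta>)" using * h by (intro mult_left_mono) auto
    finally show ?thesis using h by simp
  qed
  then show ?thesis using that[of "min d 1"] d(1) by simp
qed

text \<open>This is the device that creates new functions: difference quotients in a parameter are linear combinations
of approximable functions, and they converge in \<open>C\<^sup>1\<close>.\<close>
lemma C1_approx_parameter_derivative:
  fixes F :: "real \<Rightarrow> 'a::euclidean_space \<Rightarrow> real"
  assumes K: "compact K" and approx: "\<And>s. C1_approx \<sigma> \<sigma>' K (F s) (F' s)"
    and F: "\<And>s x. ((\<lambda>s. F s x) has_real_derivative P s x) (at s)"
    and F': "\<And>s x. ((\<lambda>s. F' s x) has_vector_derivative P' s x) (at s)"
    and P: "continuous_on UNIV (\<lambda>(s, x). P s x)" and P': "continuous_on UNIV (\<lambda>(s, x). P' s x)"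
  shows "C1_approx \<sigma> \<sigma>' K (P s) (P' s)"
proof (rule C1_approx_closed)
  fix \<delta> :: real assume \<delta>: "0 < \<delta>"
  obtain d where d: "0 < d" "\<And>h x. 0 < h \<Longrightarrow> h < d \<Longrightarrow> x \<in> K \<Longrightarrow>
      norm ((1 / h) *\<^sub>R (F (s + h) x - F s x) - P s x) \<le> \<delta>"
    using uniform_difference_quotient[of K F P \<delta> s] K F continuous_on_subset[OF P] \<delta>
    by (metis has_real_derivative_iff_has_vector_derivative subset_UNIV)
  obtain d' where d': "0 < d'" "\<And>h x. 0 < h \<Longrightarrow> h < d' \<Longrightarrow> x \<in> K \<Longrightarrow>
      norm ((1 / h) *\<^sub>R (F' (s + h) x - F' s x) - P' s x) \<le> \<delta>"
    using uniform_difference_quotient[of K F' P' \<delta> s] K F' continuous_on_subset[OF P'] \<delta>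
    by (metis subset_UNIV)
  define h where "h = min d d' / 2"
  have h: "0 < h" "h < d" "h < d'" using d(1) d'(1) by (auto simp: h_def)
  have quotient: "C1_approx \<sigma> \<sigma>' K (\<lambda>x. (1 / h) * (F (s + h) x + (-1) * F s x))
      (\<lambda>x. (1 / h) *\<^sub>R (F' (s + h) x + (-1) *\<^sub>R F' s x))"
    by (intro C1_approx_scale C1_approx_add approx)
  show "\<exists>g g'. C1_approx \<sigma> \<sigma>' K g g' \<and>
      (\<forall>x\<in>K. \<bar>g x - P s x\<bar> \<le> \<delta> \<and> norm (g' x - P' s x) \<le> \<delta>)"
    by (intro exI, rule conjI, rule quotient) (use d(2)[OF h(1,2)] d'(2)[OF h(1,3)] in auto)
qed

text \<open>Apply the Weierstrass theorem to \<open>g'\<close> and integrate.\<close>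
lemma polynomial_C1_approximation:
  fixes g :: "real \<Rightarrow> real"
  assumes g: "\<And>t. t \<in> {a..b} \<Longrightarrow> (g has_real_derivative g' t) (at t)"
    and g': "continuous_on {a..b} g'" and \<delta>: "0 < \<delta>"
  obtains c :: "nat \<Rightarrow> real" and n where
    "\<And>t. t \<in> {a..b} \<Longrightarrow> \<bar>(\<Sum>i\<le>n. c i * t ^ i) - g t\<bar> \<le> \<delta>"
    "\<And>t. t \<in> {a..b} \<Longrightarrow> \<bar>(\<Sum>i\<le>n. c i * (real i * t ^ (i - 1))) - g' t\<bar> \<le> \<delta>"
proof (cases "a \<le> b")
  case True
  define \<eta> where "\<eta> = \<delta> / (b - a + 1)"
  have \<eta>: "0 < \<eta>" "\<eta> \<le> \<delta>" "\<eta> * (b - a) \<le> \<delta>" using True \<delta>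
    by (auto simp: \<eta>_def field_simps)
  obtain q where q: "real_polynomial_function q" "\<And>t. t \<in> {a..b} \<Longrightarrow> \<bar>g' t - q t\<bar> < \<eta>"
    using Stone_Weierstrass_real_polynomial_function[OF compact_Icc g' \<eta>(1)] by blast
  obtain e m where em: "q = (\<lambda>t. \<Sum>i\<le>m. e i * t ^ i)"
    using q(1) unfolding real_polynomial_function_iff_sum by blast
  define Q where "Q t = (\<Sum>i\<le>m. e i / real (Suc i) * t ^ Suc i)" for t
  define c where "c i = (if i = 0 then g a - Q a else e (i - 1) / real i)" for i
  have cP: "(\<Sum>i\<le>Suc m. c i * t ^ i) = g a - Q a + Q t" for t
    by (simp only: sum.atMost_Suc_shift) (simp add: c_def Q_def)
  have cP': "(\<Sum>i\<le>Suc m. c i * (real i * t ^ (i - 1))) = q t" for t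
    by (simp only: sum.atMost_Suc_shift) (simp add: c_def em)
  have Q: "(Q has_real_derivative q t) (at t)" for t
  proof -
    have "((\<lambda>t. e i / real (Suc i) * t ^ Suc i) has_real_derivative e i * t ^ i) (at t)" for i
      using DERIV_cmult[OF DERIV_pow[of "Suc i" t], of "e i / real (Suc i)"] by simp
    then show ?thesis unfolding Q_def em by (intro DERIV_sum)
  qed
  have "\<bar>(g a - Q a + Q t) - g t\<bar> \<le> \<delta>" if t: "t \<in> {a..b}" for t
  proof -
    have "norm ((Q t - g t) - (Q a - g a)) \<le> \<eta> * norm (t - a)"
    proof (rule field_differentiable_bound[where S = "{a..b}" and f' = "\<lambda>t. q t - g' t"])
      show "((\<lambda>t. Q t - g t) has_field_derivative q s - g' s) (at s within {a..b})"
        if "s \<in> {a..b}" for s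
        by (rule has_field_derivative_at_within, rule DERIV_diff[OF Q g[OF that]])
      show "norm (q s - g' s) \<le> \<eta>" if "s \<in> {a..b}" for s
        using q(2)[OF that] by (simp add: abs_minus_commute)
    qed (use t True in auto)
    also have "\<dots> \<le> \<eta> * (b - a)" using t \<eta> by (intro mult_left_mono) auto
    finally show ?thesis using \<eta> by simp
  qed
  then show ?thesis using that[of c "Suc m"] q(2) \<eta> unfolding cP cP'
    by (smt (verit) abs_minus_commute)
next
  case False
  then show ?thesis using that by auto
qed

section \<open>Networks in one variable\<close>

lemma DERIV_imp_continuous_on:
  fixes g :: "real \<Rightarrow> real"
  assumes "\<And>t. DERIV g t :> g' t"
  shows "continuous_on X g"
  using assms by (intro continuous_at_imp_continuous_on ballI) (rule DERIV_isCont)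

definition C1_approx_compacts :: "(real \<Rightarrow> real) \<Rightarrow> (real \<Rightarrow> real) \<Rightarrow> (real \<Rightarrow> real) \<Rightarrow> (real \<Rightarrow> real) \<Rightarrow> bool" where
  "C1_approx_compacts \<sigma> \<sigma>' g g' \<longleftrightarrow> (\<forall>X. compact X \<longrightarrow> C1_approx \<sigma> \<sigma>' X g g')"

lemma C1_approx_compacts_affine:
  assumes "C1_approx_compacts \<sigma> \<sigma>' g g'"
  shows "C1_approx_compacts \<sigma> \<sigma>' (\<lambda>t. g (a * t + b)) (\<lambda>t. a * g' (a * t + b))"
  unfolding C1_approx_compacts_def
proof (intro allI impI)
  fix X :: "real set" assume "compact X"
  then have "compact ((\<lambda>t. a * t + b) ` X)"
    by (intro compact_continuous_image continuous_intros)
  then have "C1_approx \<sigma> \<sigma>' ((\<lambda>t. a * t + b) ` X) g g'"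
    using assms by (simp add: C1_approx_compacts_def)
  from C1_approx_ridge[OF this, of X a b]
  show "C1_approx \<sigma> \<sigma>' X (\<lambda>t. g (a * t + b)) (\<lambda>t. a * g' (a * t + b))"
    by (simp add: image_iff mult.commute) blast
qed

lemma C1_approx_compacts_activation: "C1_approx_compacts \<sigma> \<sigma>' \<sigma> \<sigma>'"
  using C1_approx_ridge_sum[OF ridge_sum.neuron[of \<sigma> \<sigma>' 1 "1::real" 0]]
  by (simp add: C1_approx_compacts_def)

text \<open>Averaging gains one derivative and exchanges \<open>d/dt\<close> for the difference operator below.\<close>
definition moving_average :: "(real \<Rightarrow> real) \<Rightarrow> real \<Rightarrow> real" where
  "moving_average g t = integral {0..1} (\<lambda>u. g (t + u))"

definition forward_diff :: "(real \<Rightarrow> real) \<Rightarrow> real \<Rightarrow> real" where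
  "forward_diff g t = g (t + 1) - g t"

lemma moving_average_derivative_eq:
  assumes "\<And>t. DERIV g t :> g' t"
  shows "moving_average g' = forward_diff g"
proof
  fix t
  have "((\<lambda>u. g' (t + u)) has_integral g (t + 1) - g (t + 0)) {0..1}"
  proof (rule fundamental_theorem_of_calculus)
    fix u :: real
    have "((\<lambda>u. g (t + u)) has_field_derivative g' (t + u)) (at u)"
      using assms[of "t + u"] DERIV_shift[of g "g' (t + u)" u t] by (simp add: add.commute)
    then show "((\<lambda>u. g (t + u)) has_vector_derivative g' (t + u)) (at u within {0..1})"
      by (simp add: has_real_derivative_iff_has_vector_derivative has_vector_derivative_at_within)
  qed simp
  then show "moving_average g' t = forward_diff g t"
    by (simp add: moving_average_def forward_diff_def integral_unique)
qed

lemma continuous_on_forward_diff: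
  assumes "continuous_on UNIV g"
  shows "continuous_on UNIV (forward_diff g)"
  unfolding forward_diff_def
  by (intro continuous_intros continuous_on_compose2[OF assms]) auto

lemma continuous_on_shifted:
  assumes "continuous_on UNIV (g :: real \<Rightarrow> real)"
  shows "continuous_on X (\<lambda>(t, u). g (t + u))"
  unfolding case_prod_unfold
  by (intro continuous_on_compose2[OF assms] continuous_intros) auto

lemma DERIV_moving_average:
  assumes g: "\<And>t. DERIV g t :> g' t" and g': "continuous_on UNIV g'"
  shows "DERIV (moving_average g) t :> moving_average g' t"
proof -
  have "((\<lambda>t. integral (cbox 0 1) (\<lambda>u. g (t + u))) has_field_derivative
      integral (cbox 0 1) (\<lambda>u. g' (t + u))) (at t within UNIV)"
  proof (rule leibniz_rule_field_derivative)
    show "((\<lambda>t. g (t + u)) has_field_derivative g' (t + u)) (at t within UNIV)" for t u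
      using g[of "t + u"] by (simp add: DERIV_shift)
    have "continuous_on UNIV g" by (rule DERIV_imp_continuous_on[OF g])
    from continuous_on_slice[OF continuous_on_shifted[OF this, of "UNIV \<times> cbox 0 1"]]
    show "(\<lambda>u. g (t + u)) integrable_on cbox 0 1" for t
      by (intro integrable_continuous) simp
    show "continuous_on (UNIV \<times> cbox 0 1) (\<lambda>(t, u). g' (t + u))"
      by (rule continuous_on_shifted[OF g'])
  qed auto
  then show ?thesis by (simp add: moving_average_def[abs_def])
qed

lemma C1_approx_compacts_moving_average:
  assumes "C1_approx_compacts \<sigma> \<sigma>' g g'" and g: "continuous_on UNIV g" and g': "continuous_on UNIV g'"
  shows "C1_approx_compacts \<sigma> \<sigma>' (moving_average g) (moving_average g')"
  unfolding C1_approx_compacts_def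
proof (intro allI impI)
  fix X :: "real set" assume X: "compact X"
  have "C1_approx \<sigma> \<sigma>' X (\<lambda>t. integral (cbox 0 1) (\<lambda>u. g (t + u)))
      (\<lambda>t. integral (cbox 0 1) (\<lambda>u. g' (t + u)))"
  proof (rule C1_approx_integral[OF X])
    show "C1_approx \<sigma> \<sigma>' X (\<lambda>t. g (t + u)) (\<lambda>t. g' (t + u))" for u
      using C1_approx_compacts_affine[OF assms(1), of 1 u] X by (simp add: C1_approx_compacts_def)
  qed (intro continuous_on_shifted g g')+
  then show "C1_approx \<sigma> \<sigma>' X (moving_average g) (moving_average g')"
    by (simp add: moving_average_def[abs_def])
qed

lemma DERIV_forward_diff_iterate:
  assumes "\<And>t. DERIV g t :> g' t"
  shows "DERIV ((forward_diff ^^ j) g) t :> (forward_diff ^^ j) g' t"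
proof (induction j arbitrary: t)
  case (Suc j)
  have "DERIV (\<lambda>t. (forward_diff ^^ j) g (t + 1)) t :> (forward_diff ^^ j) g' (t + 1)"
    using Suc[of "t + 1"] by (simp add: DERIV_shift)
  from DERIV_diff[OF this Suc[of t]] show ?case by (simp add: forward_diff_def[abs_def])
qed (use assms in simp)

text \<open>Each differentiation of \<open>t ^ j * g j (a * t + b)\<close> in \<open>a\<close> brings out one more factor \<open>t\<close> and one more derivative
of \<open>g\<close>. The chain \<open>g 0, g 1, ...\<close> of derivatives must reach index \<open>k + 1\<close>, because convergence is also
required of the gradients.\<close>
lemma C1_approx_compacts_power_times_derivative:
  fixes g :: "nat \<Rightarrow> real \<Rightarrow> real"
  assumes g: "\<And>j t. j \<le> k \<Longrightarrow> DERIV (g j) t :> g (Suc j) t"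
    and cont: "continuous_on UNIV (g (Suc k))"
    and approx: "C1_approx_compacts \<sigma> \<sigma>' (g 0) (g 1)" and "j \<le> k"
  shows "C1_approx_compacts \<sigma> \<sigma>' (\<lambda>t. t ^ j * g j (a * t + b))
    (\<lambda>t. real j * t ^ (j - 1) * g j (a * t + b) + a * t ^ j * g (Suc j) (a * t + b))"
  using \<open>j \<le> k\<close>
proof (induction j arbitrary: a)
  case 0
  then show ?case using C1_approx_compacts_affine[OF approx, of a b] by simp
next
  case (Suc j)
  have c: "continuous_on UNIV (g i)" if "i \<le> Suc k" for i
  proof (cases "i = Suc k")
    case False
    then have "i \<le> k" using that by simp
    then show ?thesis using DERIV_imp_continuous_on[OF g] by blast
  qed (use cont in simp)
  have chain: "DERIV (\<lambda>s. g i (s * t + b)) s :> t * g (Suc i) (s * t + b)" if "i \<le> k" for i s t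
    by (rule DERIV_chain2[OF g[OF that], THEN DERIV_cong])
      (auto intro!: derivative_eq_intros simp: mult.commute)
  define F where "F s t = t ^ j * g j (s * t + b)" for s t
  define F' where "F' s t = real j * t ^ (j - 1) * g j (s * t + b) + s * t ^ j * g (Suc j) (s * t + b)"
    for s t
  define P where "P s t = t ^ j * (t * g (Suc j) (s * t + b))" for s t
  define P' where "P' s t = real j * t ^ (j - 1) * (t * g (Suc j) (s * t + b))
      + (t ^ j * g (Suc j) (s * t + b) + s * t ^ j * (t * g (Suc (Suc j)) (s * t + b)))" for s t
  have F: "DERIV (\<lambda>s. F s t) s :> P s t" for s t
    unfolding F_def P_def by (intro DERIV_cmult chain) (use Suc.prems in simp)
  have "DERIV (\<lambda>s. (s * t ^ j) * g (Suc j) (s * t + b)) s :>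
      t ^ j * g (Suc j) (s * t + b) + s * t ^ j * (t * g (Suc (Suc j)) (s * t + b))" for s t
    by (rule DERIV_mult'[THEN DERIV_cong, OF _ chain[OF Suc.prems]])
      (auto intro!: derivative_eq_intros)
  then have F': "DERIV (\<lambda>s. F' s t) s :> P' s t" for s t
    unfolding F'_def P'_def using Suc.prems
    by (intro DERIV_add DERIV_cmult chain) auto
  have cc: "continuous_on UNIV (\<lambda>x. g i (fst x * snd x + b))" if "i \<le> Suc k" for i
    by (intro continuous_on_compose2[OF c[OF that]] continuous_intros) auto
  have P: "continuous_on UNIV (\<lambda>(s, t). P s t)" "continuous_on UNIV (\<lambda>(s, t). P' s t)"
    unfolding P_def P'_def case_prod_unfold using Suc.prems
    by (intro continuous_intros cc; simp)+
  have "C1_approx \<sigma> \<sigma>' X (P a) (P' a)" if X: "compact X" for X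
  proof (rule C1_approx_parameter_derivative[OF X _ F _ P])
    show "C1_approx \<sigma> \<sigma>' X (F s) (F' s)" for s
      using Suc.IH[of s] Suc.prems X by (simp add: C1_approx_compacts_def F_def[abs_def] F'_def[abs_def])
    show "((\<lambda>s. F' s t) has_vector_derivative P' s t) (at s)" for s t
      using F' by (simp add: has_real_derivative_iff_has_vector_derivative)
  qed
  moreover have "P' a = (\<lambda>t. real (Suc j) * t ^ (Suc j - 1) * g (Suc j) (a * t + b)
      + a * t ^ Suc j * g (Suc (Suc j)) (a * t + b))"
    by (rule ext, cases j) (simp_all add: P'_def algebra_simps)
  moreover have "P a = (\<lambda>t. t ^ Suc j * g (Suc j) (a * t + b))"
    by (rule ext) (simp add: P_def)
  ultimately show ?case by (simp add: C1_approx_compacts_def)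
qed

lemma integrable_square_forward_diff:
  assumes "continuous_on UNIV g" "integrable lborel (\<lambda>t. (g t)\<^sup>2)"
  shows "integrable lborel (\<lambda>t. (forward_diff g t)\<^sup>2)"
proof (rule Bochner_Integration.integrable_bound)
  have "integrable lborel (\<lambda>t. (g (1 + 1 * t))\<^sup>2)"
    by (rule lborel_integrable_real_affine[OF assms(2)]) simp
  then show "integrable lborel (\<lambda>t. 2 * (g (1 + 1 * t))\<^sup>2 + 2 * (g t)\<^sup>2)"
    using assms(2) by simp
  show "(\<lambda>t. (forward_diff g t)\<^sup>2) \<in> borel_measurable lborel"
    using borel_measurable_continuous_onI[OF continuous_on_forward_diff[OF assms(1)]] by simp
  have "(x - y)\<^sup>2 \<le> 2 * x\<^sup>2 + 2 * y\<^sup>2" for x y :: real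
    using zero_le_power2[of "x + y"] by (simp add: power2_eq_square algebra_simps)
  then show "AE t in lborel. norm ((forward_diff g t)\<^sup>2) \<le> norm (2 * (g (1 + 1 * t))\<^sup>2 + 2 * (g t)\<^sup>2)"
    by (intro AE_I2) (simp add: forward_diff_def add.commute[of _ 1])
qed

text \<open>The integral of the square over \<open>n\<close> periods is \<open>n\<close> times that over one period and stays bounded, so the latter is 0.\<close>
lemma periodic_square_integrable_eq_0:
  fixes g :: "real \<Rightarrow> real"
  assumes cont: "continuous_on UNIV g" and int: "integrable lborel (\<lambda>t. (g t)\<^sup>2)"
    and per: "\<And>t. g (t + 1) = g t"
  shows "g t = 0"
proof -
  define \<phi> where "\<phi> s = (g s)\<^sup>2" for s
  have c\<phi>: "continuous_on X \<phi>" for X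
    unfolding \<phi>_def by (intro continuous_intros continuous_on_subset[OF cont]) auto
  have int\<phi>: "\<phi> integrable_on {a..b}" for a b by (rule integrable_continuous_interval[OF c\<phi>])
  have per': "\<phi> (s + real n) = \<phi> s" for s n
  proof (induction n)
    case (Suc n)
    then show ?case using per[of "s + real n"] by (simp add: \<phi>_def algebra_simps)
  qed simp
  define I where "I = integral {t..t + 1} \<phi>"
  have sum: "integral {t..t + real n} \<phi> = real n * I" for n
  proof (induction n)
    case (Suc n)
    have "integral {t..t + real (Suc n)} \<phi>
        = integral {t..t + real n} \<phi> + integral {t + real n..t + real (Suc n)} \<phi>"
      by (rule Henstock_Kurzweil_Integration.integral_combine[symmetric]) (auto intro: int\<phi>)
    also have "integral {t + real n..t + real (Suc n)} \<phi> = integral {t..t + 1} (\<lambda>s. \<phi> (s + real n))"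
      using integral_shift_Icc_real[of t "t + 1" \<phi> "real n"] by (simp add: add_ac o_def)
    also have "\<dots> = I" by (simp add: per' I_def)
    finally show ?case using Suc by (simp add: algebra_simps)
  qed simp
  have bound: "real n * I \<le> integral\<^sup>L lborel \<phi>" for n
  proof -
    have int\<phi>': "integrable lborel \<phi>" using int by (simp add: \<phi>_def[abs_def])
    have "set_integrable lborel {t..t + real n} \<phi>"
      unfolding set_integrable_def by (rule integrable_mult_indicator[OF _ int\<phi>']) simp
    then have "real n * I = (LINT s:{t..t + real n}|lborel. \<phi> s)"
      by (subst set_borel_integral_eq_integral(2)) (simp_all add: sum)
    also have "\<dots> \<le> integral\<^sup>L lborel \<phi>"
      unfolding set_lebesgue_integral_def
      by (intro integral_mono integrable_mult_indicator int\<phi>')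
        (auto simp: indicator_def \<phi>_def)
    finally show ?thesis .
  qed
  have "I \<le> 0"
  proof (rule ccontr)
    assume "\<not> I \<le> 0"
    then obtain n where "integral\<^sup>L lborel \<phi> < real n * I"
      using reals_Archimedean3[of I] by auto
    then show False using bound[of n] by simp
  qed
  moreover have "0 \<le> I" unfolding I_def by (rule integral_nonneg[OF int\<phi>]) (simp add: \<phi>_def)
  ultimately have "I = 0" by simp
  then have "\<forall>s\<in>{t..t + 1}. \<phi> s = 0"
    unfolding I_def by (subst (asm) integral_eq_0_iff[OF c\<phi>]) (auto simp: \<phi>_def)
  then show ?thesis by (simp add: \<phi>_def)
qed

lemma forward_diff_iterate_nonzero:
  assumes "continuous_on UNIV g" "integrable lborel (\<lambda>t. (g t)\<^sup>2)" "g \<noteq> (\<lambda>t. 0)"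
  shows "(forward_diff ^^ k) g \<noteq> (\<lambda>t. 0)"
proof -
  have "continuous_on UNIV ((forward_diff ^^ k) g) \<and>
    integrable lborel (\<lambda>t. ((forward_diff ^^ k) g t)\<^sup>2) \<and> (forward_diff ^^ k) g \<noteq> (\<lambda>t. 0)"
  proof (induction k)
    case (Suc k)
    then have IH: "continuous_on UNIV ((forward_diff ^^ k) g)"
      "integrable lborel (\<lambda>t. ((forward_diff ^^ k) g t)\<^sup>2)" "(forward_diff ^^ k) g \<noteq> (\<lambda>t. 0)"
      by auto
    have "forward_diff ((forward_diff ^^ k) g) \<noteq> (\<lambda>t. 0)"
    proof
      assume "forward_diff ((forward_diff ^^ k) g) = (\<lambda>t. 0)"
      then have "(forward_diff ^^ k) g (t + 1) = (forward_diff ^^ k) g t" for t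
        by (metis eq_iff_diff_eq_0 forward_diff_def)
      from periodic_square_integrable_eq_0[OF IH(1,2) this] IH(3) show False by blast
    qed
    then show ?case
      using continuous_on_forward_diff[OF IH(1)] integrable_square_forward_diff[OF IH(1,2)] by simp
  qed (use assms in auto)
  then show ?thesis by blast
qed

text \<open>For the \<open>k\<close>-fold moving average the \<open>j\<close>-th derivative is the \<open>j\<close>-th difference of the \<open>(k - j)\<close>-fold moving
average. Evaluated at \<open>a = 0\<close>, the previous construction gives \<open>t ^ k\<close> times the constant \<open>g k b\<close>, where
\<open>g k\<close> is the \<open>k\<close>-th difference of \<open>\<sigma>\<close> and \<open>b\<close> is chosen such that the constant is not 0.\<close>
lemma C1_approx_compacts_power:
  assumes \<sigma>: "\<And>t. DERIV \<sigma> t :> \<sigma>' t" and \<sigma>': "continuous_on UNIV \<sigma>'"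
    and int: "integrable lborel (\<lambda>t. (\<sigma> t)\<^sup>2)" and nz: "\<sigma> \<noteq> (\<lambda>t. 0)"
  shows "C1_approx_compacts \<sigma> \<sigma>' (\<lambda>t. t ^ k) (\<lambda>t. real k * t ^ (k - 1))"
proof -
  have c\<sigma>: "continuous_on UNIV \<sigma>"
    by (rule DERIV_imp_continuous_on[OF \<sigma>])
  define s where "s m = (moving_average ^^ m) \<sigma>" for m
  define D where "D m = (case m of 0 \<Rightarrow> \<sigma>' | Suc m \<Rightarrow> forward_diff (s m))" for m
  have s: "(\<forall>t. DERIV (s m) t :> D m t) \<and> continuous_on UNIV (D m)
      \<and> C1_approx_compacts \<sigma> \<sigma>' (s m) (D m)" for m
  proof (induction m)
    case 0
    then show ?case using \<sigma> \<sigma>' C1_approx_compacts_activation by (simp add: s_def D_def)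
  next
    case (Suc m)
    then have IH: "\<And>t. DERIV (s m) t :> D m t" "continuous_on UNIV (D m)"
      "C1_approx_compacts \<sigma> \<sigma>' (s m) (D m)" by auto
    have cs: "continuous_on UNIV (s m)"
      by (rule DERIV_imp_continuous_on[OF IH(1)])
    have eq: "moving_average (D m) = D (Suc m)" "s (Suc m) = moving_average (s m)"
      using moving_average_derivative_eq[of "s m" "D m"] IH(1) by (auto simp: D_def s_def)
    show ?case
      using DERIV_moving_average[OF IH(1,2)] C1_approx_compacts_moving_average[OF IH(3) cs IH(2)]
        continuous_on_forward_diff[OF cs] unfolding eq by (simp add: D_def)
  qed
  define g where "g j = (if j \<le> k then (forward_diff ^^ j) (s (k - j)) else (forward_diff ^^ k) \<sigma>')" for j
  have gD: "g (Suc j) = (forward_diff ^^ j) (D (k - j))" if "j \<le> k" for j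
  proof (cases "j = k")
    case False
    then have "k - j = Suc (k - Suc j)" using that by simp
    then show ?thesis using that False by (simp add: g_def D_def funpow_swap1)
  qed (simp add: g_def D_def)
  have deriv: "DERIV (g j) t :> g (Suc j) t" if "j \<le> k" for j t
    using DERIV_forward_diff_iterate[of "s (k - j)" "D (k - j)" j t] s gD[OF that] that
    by (simp add: g_def)
  have cont: "continuous_on UNIV (g (Suc k))"
  proof -
    have "continuous_on UNIV ((forward_diff ^^ j) \<sigma>')" for j
      by (induction j) (simp_all add: \<sigma>' continuous_on_forward_diff)
    then show ?thesis by (simp add: g_def)
  qed
  have approx: "C1_approx_compacts \<sigma> \<sigma>' (g 0) (g 1)"
    using s[of k] gD[of 0] by (simp add: g_def)
  have gk: "g k = (forward_diff ^^ k) \<sigma>" by (simp add: g_def s_def)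
  obtain b where b: "g k b \<noteq> 0"
    using forward_diff_iterate_nonzero[OF c\<sigma> int nz, of k] unfolding gk by blast
  have *: "C1_approx_compacts \<sigma> \<sigma>' (\<lambda>t. t ^ k * g k (0 * t + b))
    (\<lambda>t. real k * t ^ (k - 1) * g k (0 * t + b) + 0 * t ^ k * g (Suc k) (0 * t + b))"
    by (rule C1_approx_compacts_power_times_derivative[OF deriv cont approx order_refl])
  have "C1_approx \<sigma> \<sigma>' X (\<lambda>t. (1 / g k b) * (t ^ k * g k b))
      (\<lambda>t. (1 / g k b) *\<^sub>R (real k * t ^ (k - 1) * g k b))" if "compact X" for X
    using * that by (intro C1_approx_scale) (simp add: C1_approx_compacts_def)
  then show ?thesis using b by (simp add: C1_approx_compacts_def)
qed

theorem C1_approx_compacts_C1: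
  assumes \<sigma>: "\<And>t. DERIV \<sigma> t :> \<sigma>' t" "continuous_on UNIV \<sigma>'"
      "integrable lborel (\<lambda>t. (\<sigma> t)\<^sup>2)" "\<sigma> \<noteq> (\<lambda>t. 0)"
    and g: "\<And>t. DERIV g t :> g' t" "continuous_on UNIV g'"
  shows "C1_approx_compacts \<sigma> \<sigma>' g g'"
  unfolding C1_approx_compacts_def
proof (intro allI impI)
  fix X :: "real set" assume X: "compact X"
  then obtain a b where ab: "X \<subseteq> {a..b}"
    using bounded_subset_cbox_symmetric[OF compact_imp_bounded[OF X]] by (metis box_real(2))
  show "C1_approx \<sigma> \<sigma>' X g g'"
  proof (rule C1_approx_closed)
    fix \<delta> :: real assume "0 < \<delta>"
    then obtain c n where c:
      "\<And>t. t \<in> {a..b} \<Longrightarrow> \<bar>(\<Sum>i\<le>n. c i * t ^ i) - g t\<bar> \<le> \<delta>"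
      "\<And>t. t \<in> {a..b} \<Longrightarrow> \<bar>(\<Sum>i\<le>n. c i * (real i * t ^ (i - 1))) - g' t\<bar> \<le> \<delta>"
      using polynomial_C1_approximation[of a b g g' \<delta>] g continuous_on_subset[OF g(2)] by blast
    have "C1_approx \<sigma> \<sigma>' X (\<lambda>t. \<Sum>i\<le>n. c i * t ^ i) (\<lambda>t. \<Sum>i\<le>n. c i *\<^sub>R (real i * t ^ (i - 1)))"
      using C1_approx_compacts_power[OF \<sigma>] X
      by (intro C1_approx_sum C1_approx_scale) (simp add: C1_approx_compacts_def)
    then show "\<exists>h h'. C1_approx \<sigma> \<sigma>' X h h' \<and>
        (\<forall>t\<in>X. \<bar>h t - g t\<bar> \<le> \<delta> \<and> norm (h' t - g' t) \<le> \<delta>)"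
      by (intro exI, rule conjI) (use c ab in auto)
  qed
qed

section \<open>Polynomials in several variables\<close>

lemma C1_approx_exp:
  fixes K :: "'a::euclidean_space set"
  assumes \<sigma>: "\<And>t. DERIV \<sigma> t :> \<sigma>' t" "continuous_on UNIV \<sigma>'"
      "integrable lborel (\<lambda>t. (\<sigma> t)\<^sup>2)" "\<sigma> \<noteq> (\<lambda>t. 0)"
    and K: "compact K"
  shows "C1_approx \<sigma> \<sigma>' K (\<lambda>x. exp (a \<bullet> x)) (\<lambda>x. exp (a \<bullet> x) *\<^sub>R a)"
proof -
  have "compact ((\<lambda>x. a \<bullet> x) ` K)" by (intro compact_continuous_image continuous_intros K)
  moreover have "C1_approx_compacts \<sigma> \<sigma>' exp exp"
    by (rule C1_approx_compacts_C1[OF \<sigma>]) (auto intro!: continuous_intros)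
  ultimately have "C1_approx \<sigma> \<sigma>' ((\<lambda>x. a \<bullet> x) ` K) exp exp"
    by (simp add: C1_approx_compacts_def)
  from C1_approx_ridge[OF this, of K a 0] show ?thesis by simp
qed

text \<open>Approximability of \<open>g\<close> times every exponential, with the gradient given by the product rule. Quantifying over
the frequency \<open>a\<close> is what allows differentiation with respect to it.\<close>
definition exp_stable ::
  "(real \<Rightarrow> real) \<Rightarrow> (real \<Rightarrow> real) \<Rightarrow> 'a::euclidean_space set \<Rightarrow> ('a \<Rightarrow> real) \<Rightarrow> ('a \<Rightarrow> 'a) \<Rightarrow> bool" where
  "exp_stable \<sigma> \<sigma>' K g g' \<longleftrightarrow> continuous_on UNIV g \<and> continuous_on UNIV g' \<and>
     (\<forall>a. C1_approx \<sigma> \<sigma>' K (\<lambda>x. exp (a \<bullet> x) * g x) (\<lambda>x. exp (a \<bullet> x) *\<^sub>R (g' x + g x *\<^sub>R a)))"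

lemma exp_stable_add:
  assumes "exp_stable \<sigma> \<sigma>' K g g'" "exp_stable \<sigma> \<sigma>' K h h'"
  shows "exp_stable \<sigma> \<sigma>' K (\<lambda>x. g x + h x) (\<lambda>x. g' x + h' x)"
  unfolding exp_stable_def
proof (intro conjI allI)
  fix a
  have "C1_approx \<sigma> \<sigma>' K (\<lambda>x. exp (a \<bullet> x) * g x + exp (a \<bullet> x) * h x)
    (\<lambda>x. exp (a \<bullet> x) *\<^sub>R (g' x + g x *\<^sub>R a) + exp (a \<bullet> x) *\<^sub>R (h' x + h x *\<^sub>R a))"
    using assms by (intro C1_approx_add) (simp_all add: exp_stable_def)
  then show "C1_approx \<sigma> \<sigma>' K (\<lambda>x. exp (a \<bullet> x) * (g x + h x))
    (\<lambda>x. exp (a \<bullet> x) *\<^sub>R (g' x + h' x + (g x + h x) *\<^sub>R a))"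
    by (simp add: algebra_simps)
qed (use assms in \<open>auto simp: exp_stable_def intro!: continuous_intros\<close>)

lemma exp_stable_scale:
  assumes "exp_stable \<sigma> \<sigma>' K g g'"
  shows "exp_stable \<sigma> \<sigma>' K (\<lambda>x. c * g x) (\<lambda>x. c *\<^sub>R g' x)"
  unfolding exp_stable_def
proof (intro conjI allI)
  fix a
  have "C1_approx \<sigma> \<sigma>' K (\<lambda>x. c * (exp (a \<bullet> x) * g x))
    (\<lambda>x. c *\<^sub>R (exp (a \<bullet> x) *\<^sub>R (g' x + g x *\<^sub>R a)))"
    using assms by (intro C1_approx_scale) (simp add: exp_stable_def)
  then show "C1_approx \<sigma> \<sigma>' K (\<lambda>x. exp (a \<bullet> x) * (c * g x))
    (\<lambda>x. exp (a \<bullet> x) *\<^sub>R (c *\<^sub>R g' x + (c * g x) *\<^sub>R a))"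
    by (simp add: algebra_simps)
qed (use assms in \<open>auto simp: exp_stable_def intro!: continuous_intros\<close>)

text \<open>\<open>(c \<bullet> x) * exp (a \<bullet> x)\<close> is the derivative of \<open>exp ((a + s *\<^sub>R c) \<bullet> x)\<close> with respect to \<open>s\<close> at \<open>s = 0\<close>.\<close>
lemma exp_stable_inner:
  fixes K :: "'a::euclidean_space set"
  assumes K: "compact K" and "exp_stable \<sigma> \<sigma>' K g g'"
  shows "exp_stable \<sigma> \<sigma>' K (\<lambda>x. (c \<bullet> x) * g x) (\<lambda>x. (c \<bullet> x) *\<^sub>R g' x + g x *\<^sub>R c)"
  unfolding exp_stable_def
proof (intro conjI allI)
  have g: "continuous_on UNIV g" "continuous_on UNIV g'"
    "\<And>a. C1_approx \<sigma> \<sigma>' K (\<lambda>x. exp (a \<bullet> x) * g x) (\<lambda>x. exp (a \<bullet> x) *\<^sub>R (g' x + g x *\<^sub>R a))"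
    using assms(2) by (auto simp: exp_stable_def)
  show "continuous_on UNIV (\<lambda>x. (c \<bullet> x) * g x)"
    "continuous_on UNIV (\<lambda>x. (c \<bullet> x) *\<^sub>R g' x + g x *\<^sub>R c)"
    by (intro continuous_intros g)+
  fix a
  define E where "E s x = exp ((a + s *\<^sub>R c) \<bullet> x)" for s x
  define V where "V s x = g' x + g x *\<^sub>R (a + s *\<^sub>R c)" for s x
  have E: "DERIV (\<lambda>s. E s x) s :> E s x * (c \<bullet> x)" for s x
    unfolding E_def inner_add_left inner_scaleR_left by (auto intro!: derivative_eq_intros)
  have V: "((\<lambda>s. V s x) has_vector_derivative g x *\<^sub>R c) (at s)" for s x
    unfolding V_def by (auto intro!: derivative_eq_intros)
  have gc: "continuous_on X (\<lambda>x. g (snd x))" "continuous_on X (\<lambda>x. g' (snd x))" for X :: "(real \<times> 'a) set"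
    by (intro continuous_on_compose2[OF g(1)] continuous_on_compose2[OF g(2)] continuous_intros; simp)+
  have "C1_approx \<sigma> \<sigma>' K (\<lambda>x. E 0 x * (c \<bullet> x) * g x)
      (\<lambda>x. E 0 x *\<^sub>R (g x *\<^sub>R c) + (E 0 x * (c \<bullet> x)) *\<^sub>R V 0 x)"
  proof (rule C1_approx_parameter_derivative[OF K, where F = "\<lambda>s x. E s x * g x" and
        F' = "\<lambda>s x. E s x *\<^sub>R V s x" and P = "\<lambda>s x. E s x * (c \<bullet> x) * g x" and
        P' = "\<lambda>s x. E s x *\<^sub>R (g x *\<^sub>R c) + (E s x * (c \<bullet> x)) *\<^sub>R V s x"])
    show "C1_approx \<sigma> \<sigma>' K (\<lambda>x. E s x * g x) (\<lambda>x. E s x *\<^sub>R V s x)" for s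
      unfolding E_def V_def by (rule g(3))
    show "DERIV (\<lambda>s. E s x * g x) s :> E s x * (c \<bullet> x) * g x" for s x
      by (rule DERIV_cmult_right[OF E])
    show "((\<lambda>s. E s x *\<^sub>R V s x) has_vector_derivative
        E s x *\<^sub>R (g x *\<^sub>R c) + (E s x * (c \<bullet> x)) *\<^sub>R V s x) (at s)" for s x
      by (rule has_vector_derivative_scaleR[OF E V])
    show "continuous_on UNIV (\<lambda>(s, x). E s x * (c \<bullet> x) * g x)"
      "continuous_on UNIV (\<lambda>(s, x). E s x *\<^sub>R (g x *\<^sub>R c) + (E s x * (c \<bullet> x)) *\<^sub>R V s x)"
      unfolding E_def V_def case_prod_unfold by (intro continuous_intros gc)+
  qed
  then show "C1_approx \<sigma> \<sigma>' K (\<lambda>x. exp (a \<bullet> x) * ((c \<bullet> x) * g x))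
     (\<lambda>x. exp (a \<bullet> x) *\<^sub>R ((c \<bullet> x) *\<^sub>R g' x + g x *\<^sub>R c + ((c \<bullet> x) * g x) *\<^sub>R a))"
    by (simp add: E_def V_def algebra_simps)
qed

text \<open>The induction on polynomials has to treat products of two arbitrary polynomials. It therefore shows that \<open>p\<close> acts
as a multiplier on all stable functions, a property that is closed under composition.\<close>
lemma exp_stable_times_polynomial:
  fixes K :: "'a::euclidean_space set"
  assumes K: "compact K" and p: "real_polynomial_function p"
  shows "\<exists>p'. (\<forall>x. GDERIV p x :> p' x) \<and> (\<forall>g g'. exp_stable \<sigma> \<sigma>' K g g' \<longrightarrow>
    exp_stable \<sigma> \<sigma>' K (\<lambda>x. p x * g x) (\<lambda>x. p x *\<^sub>R g' x + g x *\<^sub>R p' x))"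
  using p
proof (induction rule: real_polynomial_function.induct)
  case (linear p)
  define c where "c = adjoint p 1"
  have c: "p = (\<lambda>x. c \<bullet> x)"
    using adjoint_works[OF bounded_linear.linear[OF linear], of _ 1]
    by (auto simp: c_def inner_commute)
  have "GDERIV p x :> c" for x
    unfolding c gderiv_def by (auto intro!: derivative_eq_intros simp: inner_commute)
  then show ?case using exp_stable_inner[OF K] unfolding c by (intro exI[of _ "\<lambda>_. c"]) auto
next
  case (const c)
  then show ?case using exp_stable_scale[of \<sigma> \<sigma>' K]
    by (intro exI[of _ "\<lambda>_. 0"]) (auto intro: GDERIV_const)
next
  case (add p q)
  then obtain p' q' where p': "\<forall>x. GDERIV p x :> p' x"
    "\<And>g g'. exp_stable \<sigma> \<sigma>' K g g' \<Longrightarrow>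
      exp_stable \<sigma> \<sigma>' K (\<lambda>x. p x * g x) (\<lambda>x. p x *\<^sub>R g' x + g x *\<^sub>R p' x)"
    and q': "\<forall>x. GDERIV q x :> q' x"
    "\<And>g g'. exp_stable \<sigma> \<sigma>' K g g' \<Longrightarrow>
      exp_stable \<sigma> \<sigma>' K (\<lambda>x. q x * g x) (\<lambda>x. q x *\<^sub>R g' x + g x *\<^sub>R q' x)" by blast
  show ?case
  proof (intro exI[of _ "\<lambda>x. p' x + q' x"] conjI allI impI)
    show "GDERIV (\<lambda>x. p x + q x) x :> p' x + q' x" for x
      using p'(1) q'(1) by (intro GDERIV_add) auto
    fix g g' assume "exp_stable \<sigma> \<sigma>' K g g'"
    from exp_stable_add[OF p'(2)[OF this] q'(2)[OF this]]
    show "exp_stable \<sigma> \<sigma>' K (\<lambda>x. (p x + q x) * g x)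
        (\<lambda>x. (p x + q x) *\<^sub>R g' x + g x *\<^sub>R (p' x + q' x))"
      by (simp add: algebra_simps)
  qed
next
  case (mult p q)
  then obtain p' q' where p': "\<forall>x. GDERIV p x :> p' x"
    "\<And>g g'. exp_stable \<sigma> \<sigma>' K g g' \<Longrightarrow>
      exp_stable \<sigma> \<sigma>' K (\<lambda>x. p x * g x) (\<lambda>x. p x *\<^sub>R g' x + g x *\<^sub>R p' x)"
    and q': "\<forall>x. GDERIV q x :> q' x"
    "\<And>g g'. exp_stable \<sigma> \<sigma>' K g g' \<Longrightarrow>
      exp_stable \<sigma> \<sigma>' K (\<lambda>x. q x * g x) (\<lambda>x. q x *\<^sub>R g' x + g x *\<^sub>R q' x)" by blast
  show ?case
  proof (intro exI[of _ "\<lambda>x. p x *\<^sub>R q' x + q x *\<^sub>R p' x"] conjI allI impI)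
    show "GDERIV (\<lambda>x. p x * q x) x :> p x *\<^sub>R q' x + q x *\<^sub>R p' x" for x
      using p'(1) q'(1) by (intro GDERIV_mult) auto
    fix g g' assume "exp_stable \<sigma> \<sigma>' K g g'"
    from p'(2)[OF q'(2)[OF this]]
    show "exp_stable \<sigma> \<sigma>' K (\<lambda>x. p x * q x * g x)
        (\<lambda>x. (p x * q x) *\<^sub>R g' x + g x *\<^sub>R (p x *\<^sub>R q' x + q x *\<^sub>R p' x))"
      by (simp add: algebra_simps)
  qed
qed

lemma C1_approx_polynomial:
  fixes K :: "'a::euclidean_space set"
  assumes \<sigma>: "\<And>t. DERIV \<sigma> t :> \<sigma>' t" "continuous_on UNIV \<sigma>'"
      "integrable lborel (\<lambda>t. (\<sigma> t)\<^sup>2)" "\<sigma> \<noteq> (\<lambda>t. 0)"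
    and K: "compact K" and p: "real_polynomial_function p" "\<And>x. GDERIV p x :> p' x"
  shows "C1_approx \<sigma> \<sigma>' K p p'"
proof -
  obtain p'' where p'': "\<And>x. GDERIV p x :> p'' x" "\<And>g g'. exp_stable \<sigma> \<sigma>' K g g' \<Longrightarrow>
    exp_stable \<sigma> \<sigma>' K (\<lambda>x. p x * g x) (\<lambda>x. p x *\<^sub>R g' x + g x *\<^sub>R p'' x)"
    using exp_stable_times_polynomial[OF K p(1)] by metis
  have "p'' = p'" using gradient_eqI[OF p(2)] gradient_eqI[OF p''(1)] by auto
  moreover have "exp_stable \<sigma> \<sigma>' K (\<lambda>x. 1) (\<lambda>x. 0)"
    unfolding exp_stable_def using C1_approx_exp[OF \<sigma> K] by simp
  from p''(2)[OF this] have "exp_stable \<sigma> \<sigma>' K p p''" by simp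
  then have "C1_approx \<sigma> \<sigma>' K (\<lambda>x. exp (0 \<bullet> x) * p x) (\<lambda>x. exp (0 \<bullet> x) *\<^sub>R (p'' x + p x *\<^sub>R 0))"
    unfolding exp_stable_def by blast
  ultimately show ?thesis by simp
qed

section \<open>A continuously differentiable kernel\<close>

text \<open>At the kink \<open>t = 0\<close> a case distinction would be needed; the quadratic remainder bound covers all points at once.\<close>
lemma DERIV_positive_part_square: "DERIV (\<lambda>t. (max 0 t)\<^sup>2) t :> 2 * max 0 (t::real)"
proof -
  have bound: "\<bar>(max 0 y)\<^sup>2 - (max 0 t)\<^sup>2 - (y - t) * (2 * max 0 t)\<bar> \<le> (y - t)\<^sup>2" for y :: real
  proof -
    have "(max 0 y)\<^sup>2 - (max 0 t)\<^sup>2 - (y - t) * (2 * max 0 t)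
        = (max 0 y - max 0 t)\<^sup>2 + 2 * max 0 t * (max 0 y - y - (max 0 t - t))"
      by (simp add: power2_eq_square algebra_simps)
    moreover have "(max 0 y - max 0 t)\<^sup>2 + 2 * max 0 t * (max 0 y - y - (max 0 t - t)) \<le> (y - t)\<^sup>2"
    proof (cases "t \<le> 0 \<or> 0 \<le> y")
      case True
      have "(max 0 y - max 0 t)\<^sup>2 \<le> (y - t)\<^sup>2"
        by (subst abs_le_square_iff[symmetric]) auto
      moreover have "max 0 t * (max 0 y - y - (max 0 t - t)) \<le> 0"
        using True by (auto simp: max_def)
      ultimately show ?thesis by linarith
    next
      case False
      then have "max 0 t = t" "max 0 y = 0" by auto
      then show ?thesis using zero_le_power2[of y] by (simp add: power2_eq_square algebra_simps)
    qed
    moreover have "0 \<le> max 0 t * (max 0 y - y - (max 0 t - t))"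
      by (cases "0 \<le> t") (auto simp: max_def)
    ultimately show ?thesis by auto
  qed
  show ?thesis
    unfolding has_field_derivative_def has_derivative_at_alt
  proof (intro conjI allI impI)
    show "bounded_linear ((*) (2 * max 0 t))" by (rule bounded_linear_mult_right)
    fix e :: real assume e: "0 < e"
    have "norm ((max 0 y)\<^sup>2 - (max 0 t)\<^sup>2 - 2 * max 0 t * (y - t)) \<le> e * norm (y - t)"
      if "norm (y - t) < e" for y
    proof -
      have "\<bar>(max 0 y)\<^sup>2 - (max 0 t)\<^sup>2 - 2 * max 0 t * (y - t)\<bar> \<le> \<bar>y - t\<bar> * \<bar>y - t\<bar>"
        using bound[of y] by (simp add: mult.commute power2_eq_square flip: abs_mult)
      also have "\<dots> \<le> e * \<bar>y - t\<bar>" using that by (intro mult_right_mono) auto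
      finally show ?thesis by simp
    qed
    then show "\<exists>d>0. \<forall>y. norm (y - t) < d \<longrightarrow>
        norm ((max 0 y)\<^sup>2 - (max 0 t)\<^sup>2 - 2 * max 0 t * (y - t)) \<le> e * norm (y - t)"
      using e by blast
  qed
qed

text \<open>An unnormalised kernel of class \<open>C\<^sup>1\<close>. It is a function of the polynomial \<open>u \<bullet> u\<close>, so that approximating the
one-variable profile by polynomials approximates the kernel by polynomials.\<close>
definition bump :: "real \<Rightarrow> 'a::euclidean_space \<Rightarrow> real" where
  "bump r u = (max 0 (r\<^sup>2 - u \<bullet> u))\<^sup>2"

definition bump_grad :: "real \<Rightarrow> 'a::euclidean_space \<Rightarrow> 'a" where
  "bump_grad r u = (- 4 * max 0 (r\<^sup>2 - u \<bullet> u)) *\<^sub>R u"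

lemma bump_nonneg: "0 \<le> bump r u"
  by (simp add: bump_def)

lemma bump_eq_0: "0 \<le> r \<Longrightarrow> r \<le> norm u \<Longrightarrow> bump r u = 0"
  using power_mono[of r "norm u" 2] by (simp add: bump_def power2_norm_eq_inner)

lemma continuous_on_bump [continuous_intros]:
  "continuous_on X f \<Longrightarrow> continuous_on X (\<lambda>x. bump r (f x))"
  unfolding bump_def by (intro continuous_intros)

lemma continuous_on_bump_grad [continuous_intros]:
  "continuous_on X f \<Longrightarrow> continuous_on X (\<lambda>x. bump_grad r (f x))"
  unfolding bump_grad_def by (intro continuous_intros)

lemma GDERIV_norm_square_diff: "GDERIV (\<lambda>x. (x - z) \<bullet> (x - z)) x :> 2 *\<^sub>R (x - z)"
  unfolding gderiv_def
  by (auto intro!: derivative_eq_intros simp: inner_commute algebra_simps)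

lemma DERIV_bump_profile: "DERIV (\<lambda>s. (max 0 (r\<^sup>2 - s))\<^sup>2) s :> - 2 * max 0 (r\<^sup>2 - (s::real))"
proof -
  have "DERIV (\<lambda>s. r\<^sup>2 - s) s :> - 1" by (auto intro!: derivative_eq_intros)
  from DERIV_chain2[OF DERIV_positive_part_square this] show ?thesis by simp
qed

lemma GDERIV_bump: "GDERIV (\<lambda>x. bump r (x - z)) x :> bump_grad r (x - z)"
  using GDERIV_DERIV_compose[OF GDERIV_norm_square_diff DERIV_bump_profile, of r z x]
  by (simp add: bump_def bump_grad_def)

lemma C1_approx_bump:
  fixes K :: "'a::euclidean_space set"
  assumes \<sigma>: "\<And>t. DERIV \<sigma> t :> \<sigma>' t" "continuous_on UNIV \<sigma>'"
      "integrable lborel (\<lambda>t. (\<sigma> t)\<^sup>2)" "\<sigma> \<noteq> (\<lambda>t. 0)"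
    and K: "compact K"
  shows "C1_approx \<sigma> \<sigma>' K (\<lambda>x. bump r (x - z)) (\<lambda>x. bump_grad r (x - z))"
proof (rule C1_approx_closed)
  fix \<delta> :: real assume \<delta>: "0 < \<delta>"
  obtain b where b: "0 < b" "\<And>x. x \<in> K \<Longrightarrow> norm (x - z) \<le> b"
  proof -
    have "bounded ((\<lambda>x. x - z) ` K)"
      by (intro compact_imp_bounded compact_continuous_image continuous_intros K)
    then show ?thesis using that unfolding bounded_pos by auto
  qed
  define \<eta> where "\<eta> = min \<delta> (\<delta> / (2 * b))"
  have \<eta>: "0 < \<eta>" "\<eta> \<le> \<delta>" "2 * b * \<eta> \<le> \<delta>"
    using \<delta> b(1) by (auto simp: \<eta>_def min_def field_simps)
  obtain c n where c:
    "\<And>s. s \<in> {0..b\<^sup>2} \<Longrightarrow> \<bar>(\<Sum>i\<le>n. c i * s ^ i) - (max 0 (r\<^sup>2 - s))\<^sup>2\<bar> \<le> \<eta>"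
    "\<And>s. s \<in> {0..b\<^sup>2} \<Longrightarrow> \<bar>(\<Sum>i\<le>n. c i * (real i * s ^ (i - 1))) - (- 2 * max 0 (r\<^sup>2 - s))\<bar> \<le> \<eta>"
  proof (rule polynomial_C1_approximation[OF DERIV_bump_profile _ \<eta>(1), where a = 0 and b = "b\<^sup>2"])
    show "continuous_on {0..b\<^sup>2} (\<lambda>s. - 2 * max 0 (r\<^sup>2 - s))" by (intro continuous_intros)
  qed blast
  define sq where "sq x = (x - z) \<bullet> (x - z)" for x
  define P where "P s = (\<Sum>i\<le>n. c i * s ^ i)" for s :: real
  define P' where "P' s = (\<Sum>i\<le>n. c i * (real i * s ^ (i - 1)))" for s :: real
  have P: "DERIV P s :> P' s" for s
    unfolding P_def P'_def by (intro DERIV_sum DERIV_cmult) (use DERIV_pow in auto)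
  have "real_polynomial_function (\<lambda>x. (x - z) \<bullet> i)" for i
    unfolding inner_diff_left
    by (intro real_polynomial_function_diff real_polynomial_function.intros(1)
        real_polynomial_function.intros(2) bounded_linear_inner_left)
  moreover have sq_eq: "sq = (\<lambda>x. \<Sum>i\<in>Basis. ((x - z) \<bullet> i) * ((x - z) \<bullet> i))"
    unfolding sq_def by (rule ext) (rule euclidean_inner)
  ultimately have "real_polynomial_function sq"
    unfolding sq_eq
    by (intro real_polynomial_function_sum real_polynomial_function.intros(4)) auto
  then have "real_polynomial_function (\<lambda>x. P (sq x))"
    unfolding P_def
    by (intro real_polynomial_function_sum real_polynomial_function.intros(4)
        real_polynomial_function.intros(2) real_polynomial_function_power) auto
  moreover have "GDERIV (\<lambda>x. P (sq x)) x :> P' (sq x) *\<^sub>R (2 *\<^sub>R (x - z))" for x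
    unfolding sq_def by (rule GDERIV_DERIV_compose[OF GDERIV_norm_square_diff P])
  ultimately have approx: "C1_approx \<sigma> \<sigma>' K (\<lambda>x. P (sq x)) (\<lambda>x. P' (sq x) *\<^sub>R (2 *\<^sub>R (x - z)))"
    by (rule C1_approx_polynomial[OF \<sigma> K])
  have "\<bar>P (sq x) - bump r (x - z)\<bar> \<le> \<delta> \<and>
      norm (P' (sq x) *\<^sub>R (2 *\<^sub>R (x - z)) - bump_grad r (x - z)) \<le> \<delta>" if x: "x \<in> K" for x
  proof
    have s: "sq x \<in> {0..b\<^sup>2}"
      using power_mono[OF b(2)[OF x], of 2] by (simp add: sq_def power2_norm_eq_inner)
    show "\<bar>P (sq x) - bump r (x - z)\<bar> \<le> \<delta>"
      using c(1)[OF s] \<eta>(2) by (simp add: P_def bump_def sq_def)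
    have "P' (sq x) *\<^sub>R (2 *\<^sub>R (x - z)) - bump_grad r (x - z)
        = (P' (sq x) - (- 2 * max 0 (r\<^sup>2 - sq x))) *\<^sub>R (2 *\<^sub>R (x - z))"
      by (simp add: bump_grad_def sq_def algebra_simps)
    then have "norm (P' (sq x) *\<^sub>R (2 *\<^sub>R (x - z)) - bump_grad r (x - z))
        = \<bar>P' (sq x) - (- 2 * max 0 (r\<^sup>2 - sq x))\<bar> * (2 * norm (x - z))"
      by (simp only: norm_scaleR abs_numeral)
    also have "\<dots> \<le> \<eta> * (2 * b)"
      using c(2)[OF s] b(2)[OF x] \<eta>(1) by (intro mult_mono) (auto simp: P'_def)
    finally show "norm (P' (sq x) *\<^sub>R (2 *\<^sub>R (x - z)) - bump_grad r (x - z)) \<le> \<delta>"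
      using \<eta>(3) by (simp add: mult_ac)
  qed
  then show "\<exists>h h'. C1_approx \<sigma> \<sigma>' K h h' \<and> (\<forall>x\<in>K.
      \<bar>h x - bump r (x - z)\<bar> \<le> \<delta> \<and> norm (h' x - bump_grad r (x - z)) \<le> \<delta>)"
    using approx by blast
qed

section \<open>Mollified functions and their directional derivatives\<close>

text \<open>The integral extends over a fixed box. As long as the box contains the ball of radius \<open>r\<close> about \<open>x\<close>, this is
convolution with the kernel.\<close>
definition mollify :: "'a::euclidean_space \<Rightarrow> 'a \<Rightarrow> real \<Rightarrow> ('a \<Rightarrow> real) \<Rightarrow> 'a \<Rightarrow> real" where
  "mollify a b r G x = integral (cbox a b) (\<lambda>z. G z * bump r (x - z))"

definition mollify_grad :: "'a::euclidean_space \<Rightarrow> 'a \<Rightarrow> real \<Rightarrow> ('a \<Rightarrow> real) \<Rightarrow> 'a \<Rightarrow> 'a" where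
  "mollify_grad a b r G x = integral (cbox a b) (\<lambda>z. G z *\<^sub>R bump_grad r (x - z))"

lemma C1_approx_mollify:
  fixes K :: "'a::euclidean_space set"
  assumes \<sigma>: "\<And>t. DERIV \<sigma> t :> \<sigma>' t" "continuous_on UNIV \<sigma>'"
      "integrable lborel (\<lambda>t. (\<sigma> t)\<^sup>2)" "\<sigma> \<noteq> (\<lambda>t. 0)"
    and K: "compact K" and G: "continuous_on UNIV G"
  shows "C1_approx \<sigma> \<sigma>' K (mollify a b r G) (mollify_grad a b r G)"
  unfolding mollify_def[abs_def] mollify_grad_def[abs_def]
proof (rule C1_approx_integral[OF K])
  have "continuous_on X (\<lambda>x. G (snd x))" for X :: "('a \<times> 'a) set"
    by (intro continuous_on_compose2[OF G] continuous_intros) simp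
  then show "continuous_on (K \<times> cbox a b) (\<lambda>(x, z). G z * bump r (x - z))"
    "continuous_on (K \<times> cbox a b) (\<lambda>(x, z). G z *\<^sub>R bump_grad r (x - z))"
    unfolding case_prod_unfold by (intro continuous_intros; blast)+
  show "C1_approx \<sigma> \<sigma>' K (\<lambda>x. G z * bump r (x - z)) (\<lambda>x. G z *\<^sub>R bump_grad r (x - z))" for z
    by (intro C1_approx_scale C1_approx_bump[OF \<sigma> K])
qed

lemma DERIV_mollify_along_line:
  assumes G: "continuous_on UNIV G"
  shows "DERIV (\<lambda>s. mollify a b r G (x + s *\<^sub>R v)) 0 :> mollify_grad a b r G x \<bullet> v"
proof -
  have cG: "continuous_on X (\<lambda>x. G (snd x))" for X :: "(real \<times> 'a) set"
    by (intro continuous_on_compose2[OF G] continuous_intros) simp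
  have "((\<lambda>s. integral (cbox a b) (\<lambda>z. G z * bump r (x + s *\<^sub>R v - z))) has_field_derivative
      integral (cbox a b) (\<lambda>z. G z * (bump_grad r (x + 0 *\<^sub>R v - z) \<bullet> v))) (at 0 within UNIV)"
  proof (rule leibniz_rule_field_derivative)
    show "((\<lambda>s. G z * bump r (x + s *\<^sub>R v - z)) has_field_derivative
        G z * (bump_grad r (x + s *\<^sub>R v - z) \<bullet> v)) (at s within UNIV)" for s z
    proof (rule DERIV_cmult)
      have "((\<lambda>s. x + s *\<^sub>R v) has_derivative (\<lambda>h. h *\<^sub>R v)) (at s)"
        by (auto intro!: derivative_eq_intros)
      from has_derivative_compose[OF this GDERIV_bump[of r z "x + s *\<^sub>R v", unfolded gderiv_def]]
      show "((\<lambda>s. bump r (x + s *\<^sub>R v - z)) has_field_derivative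
          bump_grad r (x + s *\<^sub>R v - z) \<bullet> v) (at s within UNIV)"
        by (simp add: has_field_derivative_def inner_commute mult.commute[of _ "v \<bullet> _"])
    qed
    show "(\<lambda>z. G z * bump r (x + s *\<^sub>R v - z)) integrable_on cbox a b" for s
      by (intro integrable_continuous continuous_intros continuous_on_subset[OF G]) auto
    show "continuous_on (UNIV \<times> cbox a b) (\<lambda>(s, z). G z * (bump_grad r (x + s *\<^sub>R v - z) \<bullet> v))"
      unfolding case_prod_unfold by (intro continuous_intros cG)
  qed auto
  moreover have "integral (cbox a b) (\<lambda>z. G z * (bump_grad r (x - z) \<bullet> v)) = mollify_grad a b r G x \<bullet> v"
  proof -
    have "(\<lambda>z. G z *\<^sub>R bump_grad r (x - z)) integrable_on cbox a b"
      by (intro integrable_continuous continuous_intros continuous_on_subset[OF G]) auto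
    from integral_linear[OF this bounded_linear_inner_left[of v]]
    show ?thesis by (simp add: mollify_grad_def o_def)
  qed
  ultimately show ?thesis by (simp add: mollify_def)
qed

text \<open>In this form \<open>x\<close> enters through \<open>G\<close> alone, so that increments of the mollified function are averages of
increments of \<open>G\<close>.\<close>
lemma mollify_eq_shifted_integral:
  fixes x :: "'a::euclidean_space"
  assumes r: "0 < r" and sub: "ball x r \<subseteq> cbox a b"
  shows "mollify a b r G x = integral (cbox (- r *\<^sub>R One) (r *\<^sub>R One)) (\<lambda>u. G (x + u) * bump r u)"
proof -
  define h where "h z = G z * bump r (x - z)" for z
  have h0: "h z = 0" if "z \<notin> ball x r" for z
    using bump_eq_0[of r "x - z"] that r by (simp add: h_def dist_norm)
  have Q: "ball x r \<subseteq> cbox (- r *\<^sub>R One + x) (r *\<^sub>R One + x)"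
  proof
    fix z assume "z \<in> ball x r"
    then have "\<bar>(z - x) \<bullet> i\<bar> \<le> r" if "i \<in> Basis" for i
      using Basis_le_norm[OF that, of "z - x"] by (simp add: dist_norm norm_minus_commute)
    then show "z \<in> cbox (- r *\<^sub>R One + x) (r *\<^sub>R One + x)"
      by (fastforce simp: mem_box inner_add_left inner_diff_left abs_le_iff)
  qed
  have *: "integral X h = integral UNIV h" if "ball x r \<subseteq> X" for X
  proof -
    have "(\<lambda>z. if z \<in> X then h z else 0) = h"
      using h0 subsetD[OF that] by (intro ext) metis
    then show ?thesis using integral_restrict_UNIV[of X h] by simp
  qed
  have "mollify a b r G x = integral (cbox a b) h" by (simp add: mollify_def h_def[abs_def])
  also have "\<dots> = integral (cbox (- r *\<^sub>R One + x) (r *\<^sub>R One + x)) h"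
    using *[OF sub] *[OF Q] by simp
  also have "\<dots> = integral (cbox (- r *\<^sub>R One) (r *\<^sub>R One)) (h \<circ> (+) x)"
    by (rule integral_shift_cbox_plus[symmetric])
  also have "h \<circ> (+) x = (\<lambda>u. G (x + u) * bump r u)"
    by (auto simp: h_def bump_def)
  finally show ?thesis .
qed

definition bump_mass :: "'a::euclidean_space itself \<Rightarrow> real \<Rightarrow> real" where
  "bump_mass _ r = integral (cbox (- r *\<^sub>R One) (r *\<^sub>R One)) (bump r :: 'a \<Rightarrow> real)"

lemma bump_mass_pos:
  assumes "0 < r"
  shows "0 < bump_mass TYPE('a::euclidean_space) r"
proof -
  let ?Q = "cbox (- r *\<^sub>R One) (r *\<^sub>R One) :: 'a set"
  have c: "continuous_on ?Q (bump r)" by (intro continuous_intros)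
  have "0 \<le> integral ?Q (bump r)"
    by (intro integral_nonneg integrable_continuous c bump_nonneg)
  moreover have "integral ?Q (bump r) \<noteq> 0"
  proof
    assume "integral ?Q (bump r) = 0"
    moreover have "box (- r *\<^sub>R One) (r *\<^sub>R One) \<noteq> ({} :: 'a set)"
      using assms by (simp add: box_ne_empty)
    ultimately have "\<forall>u\<in>?Q. bump r u = 0"
      using integral_cbox_eq_0_iff[OF c] bump_nonneg by blast
    then have "bump r (0 :: 'a) = 0" using assms by (simp add: mem_box)
    then show False using assms by (simp add: bump_def)
  qed
  ultimately show ?thesis by (simp add: bump_mass_def)
qed

text \<open>The increments of \<open>G\<close> in the direction \<open>v\<close> have slope within \<open>c\<close> of \<open>m\<close>. Averaging over the kernel keeps this, and
letting the increment tend to 0 passes it on to the derivative.\<close>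
lemma mollify_grad_directional:
  fixes x :: "'a::euclidean_space"
  assumes G: "continuous_on UNIV G" and r: "0 < r" and sub: "ball x (2 * r) \<subseteq> cbox a b"
    and fit: "\<And>y s. 0 < s \<Longrightarrow> y \<in> ball x (2 * r) \<Longrightarrow> y + s *\<^sub>R v \<in> ball x (2 * r) \<Longrightarrow>
      \<bar>G (y + s *\<^sub>R v) - G y - s * m\<bar> \<le> s * c"
  shows "\<bar>mollify_grad a b r G x \<bullet> v - bump_mass TYPE('a) r * m\<bar> \<le> bump_mass TYPE('a) r * c"
proof -
  let ?Q = "cbox (- r *\<^sub>R One) (r *\<^sub>R One) :: 'a set"
  define I where "I = bump_mass TYPE('a) r"
  define T where "T = mollify a b r G"
  have quot: "\<bar>(T (x + s *\<^sub>R v) - T x) / s - I * m\<bar> \<le> I * c"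
    if s: "0 < s" "s * norm v < r" for s
  proof -
    have xs: "ball (x + s *\<^sub>R v) r \<subseteq> ball x (2 * r)"
    proof
      fix y assume "y \<in> ball (x + s *\<^sub>R v) r"
      then show "y \<in> ball x (2 * r)"
        using s dist_triangle[of x y "x + s *\<^sub>R v"] by (simp add: dist_norm)
    qed
    have T1: "T (x + s *\<^sub>R v) = integral ?Q (\<lambda>u. G (x + s *\<^sub>R v + u) * bump r u)"
      unfolding T_def by (rule mollify_eq_shifted_integral[OF r]) (use xs sub in blast)
    have T0: "T x = integral ?Q (\<lambda>u. G (x + u) * bump r u)"
      unfolding T_def by (rule mollify_eq_shifted_integral[OF r]) (use r sub in auto)
    have int: "(\<lambda>u. G (y + u) * bump r u) integrable_on ?Q" "bump r integrable_on ?Q" for y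
      by (intro integrable_continuous continuous_intros continuous_on_compose2[OF G]; simp)+
    have "((\<lambda>u. G (x + s *\<^sub>R v + u) * bump r u - G (x + u) * bump r u - bump r u * (s * m))
        has_integral T (x + s *\<^sub>R v) - T x - I * (s * m)) ?Q"
      unfolding T1 T0 I_def bump_mass_def
      by (intro has_integral_diff has_integral_mult_left integrable_integral int)
    then have "integral ?Q (\<lambda>u. G (x + s *\<^sub>R v + u) * bump r u - G (x + u) * bump r u - bump r u * (s * m))
        = T (x + s *\<^sub>R v) - T x - I * (s * m)" by (rule integral_unique)
    moreover have "norm (integral ?Q (\<lambda>u. G (x + s *\<^sub>R v + u) * bump r u - G (x + u) * bump r u
          - bump r u * (s * m))) \<le> integral ?Q (\<lambda>u. bump r u * (s * c))"
    proof (rule integral_norm_bound_integral)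
      fix u assume "u \<in> ?Q"
      show "norm (G (x + s *\<^sub>R v + u) * bump r u - G (x + u) * bump r u - bump r u * (s * m))
          \<le> bump r u * (s * c)"
      proof (cases "r \<le> norm u")
        case True
        then show ?thesis using bump_eq_0[of r u] r by simp
      next
        case False
        have "x + u \<in> ball x (2 * r)" using False r by (simp add: dist_norm)
        moreover have "x + u + s *\<^sub>R v \<in> ball x (2 * r)"
        proof -
          have "norm (u + s *\<^sub>R v) < 2 * r"
            using False s norm_triangle_ineq[of u "s *\<^sub>R v"] by simp
          then show ?thesis using norm_minus_cancel[of "u + s *\<^sub>R v"] by (simp add: dist_norm)
        qed
        ultimately have "\<bar>G (x + u + s *\<^sub>R v) - G (x + u) - s * m\<bar> \<le> s * c"
          by (rule fit[OF s(1)])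
        then have "bump r u * \<bar>G (x + s *\<^sub>R v + u) - G (x + u) - s * m\<bar> \<le> bump r u * (s * c)"
          by (intro mult_left_mono bump_nonneg) (simp add: add_ac)
        moreover have "G (x + s *\<^sub>R v + u) * bump r u - G (x + u) * bump r u - bump r u * (s * m)
           = bump r u * (G (x + s *\<^sub>R v + u) - G (x + u) - s * m)" by (simp add: algebra_simps)
        ultimately show ?thesis by (simp add: abs_mult bump_nonneg)
      qed
    next
      show "(\<lambda>u. G (x + s *\<^sub>R v + u) * bump r u - G (x + u) * bump r u - bump r u * (s * m)) integrable_on ?Q"
        by (rule integrable_diff[OF integrable_diff[OF int(1) int(1)] integrable_on_mult_left[OF int(2)]])
      show "(\<lambda>u. bump r u * (s * c)) integrable_on ?Q"
        by (rule integrable_on_mult_left[OF int(2)])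
    qed
    moreover have "integral ?Q (\<lambda>u. bump r u * (s * c)) = I * (s * c)"
      by (simp add: I_def bump_mass_def)
    ultimately have "\<bar>T (x + s *\<^sub>R v) - T x - I * (s * m)\<bar> \<le> I * (s * c)"
      by (simp only: real_norm_def)
    then have "\<bar>T (x + s *\<^sub>R v) - T x - I * (s * m)\<bar> / s \<le> I * c"
      using s(1) by (simp add: field_simps)
    moreover have "(T (x + s *\<^sub>R v) - T x) / s - I * m = (T (x + s *\<^sub>R v) - T x - I * (s * m)) / s"
      using s(1) by (simp add: field_simps)
    ultimately show ?thesis using s(1) by (simp add: abs_divide)
  qed
  have "((\<lambda>s. (T (x + s *\<^sub>R v) - T x) / s) \<longlongrightarrow> mollify_grad a b r G x \<bullet> v) (at_right 0)"
    using DERIV_mollify_along_line[OF G, of a b r x v, THEN DERIV_D]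
    by (simp add: T_def filterlim_at_split)
  then have lim: "((\<lambda>s. \<bar>(T (x + s *\<^sub>R v) - T x) / s - I * m\<bar>) \<longlongrightarrow>
      \<bar>mollify_grad a b r G x \<bullet> v - I * m\<bar>) (at_right 0)"
    by (intro tendsto_intros)
  have "((\<lambda>s. s * norm v) \<longlongrightarrow> 0 * norm v) (at_right 0)" by (intro tendsto_intros)
  then have "\<forall>\<^sub>F s in at_right 0. s * norm v < r"
    by (rule order_tendstoD(2)) (use r in simp)
  moreover have "\<forall>\<^sub>F s in at_right (0::real). 0 < s" by (rule eventually_at_right_less)
  ultimately have "\<forall>\<^sub>F s in at_right 0. \<bar>(T (x + s *\<^sub>R v) - T x) / s - I * m\<bar> \<le> I * c"
    by eventually_elim (rule quot)
  then show ?thesis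
    using tendsto_upperbound[OF lim] by (simp add: I_def)
qed

section \<open>Uniform approximation of the vector field\<close>

text \<open>Mollify the continuous function \<open>G\<close> of \<open>local_approximation_of_differentiable\<close> at half its radius, divide by the mass
of the kernel, and approximate the result by a network. Half of the error budget goes to the first step, half
to the last.\<close>
theorem C1_uniform_approximation:
  fixes H :: "'a::euclidean_space \<Rightarrow> real" and f :: "'a \<Rightarrow> 'b::euclidean_space" and B :: "'b \<Rightarrow> 'a"
  assumes \<sigma>: "\<And>t. DERIV \<sigma> t :> \<sigma>' t" "continuous_on UNIV \<sigma>'"
      "integrable lborel (\<lambda>t. (\<sigma> t)\<^sup>2)" "\<sigma> \<noteq> (\<lambda>t. 0)"
    and K: "compact K" and H: "\<And>x. x \<in> K \<Longrightarrow> GDERIV H x :> g x"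
    and fB: "\<And>x w. x \<in> K \<Longrightarrow> f x \<bullet> w = g x \<bullet> B w" and f: "continuous_on K f"
    and B: "linear B" and e: "0 < e"
  obtains n n' where "ridge_sum \<sigma> \<sigma>' n n'"
    "\<And>x w. x \<in> K \<Longrightarrow> \<bar>n' x \<bullet> B w - f x \<bullet> w\<bar> \<le> e * norm w"
proof -
  obtain \<Lambda> where \<Lambda>: "0 < \<Lambda>" "\<And>w. norm (B w) \<le> \<Lambda> * norm w"
    using linear_bounded_pos[OF B] by blast
  define e1 where "e1 = e / (2 * (8 * \<Lambda> + 1))"
  have e1: "0 < e1" "(8 * \<Lambda> + 1) * e1 = e / 2"
    using e \<Lambda>(1) by (auto simp: e1_def field_simps)
  obtain G \<rho> q where G: "continuous_on UNIV G" "0 < \<rho>"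
    "locally_fits H f B G K \<rho> q ((8 * \<Lambda> + 1) * e1)"
    using local_approximation_of_differentiable[OF K H fB f \<Lambda>(2) e1(1)] by blast
  define r where "r = \<rho> / 2"
  have r: "0 < r" "2 * r = \<rho>" using G(2) by (auto simp: r_def)
  obtain a b where ab: "\<And>x. x \<in> K \<Longrightarrow> ball x \<rho> \<subseteq> cbox a b"
  proof -
    have "bounded (\<Union>x\<in>K. \<Union>y\<in>ball 0 \<rho>. {x + y})"
      by (rule bounded_sums[OF compact_imp_bounded[OF K] bounded_ball])
    then obtain c where c: "(\<Union>x\<in>K. \<Union>y\<in>ball 0 \<rho>. {x + y}) \<subseteq> cbox (-c) c"
      using bounded_subset_cbox_symmetric by blast
    have "ball x \<rho> \<subseteq> cbox (-c) c" if "x \<in> K" for x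
    proof
      fix y assume "y \<in> ball x \<rho>"
      then have "y - x \<in> ball 0 \<rho>" by (simp add: dist_norm norm_minus_commute)
      then show "y \<in> cbox (-c) c" using c that by force
    qed
    then show ?thesis using that by blast
  qed
  define I where "I = bump_mass TYPE('a) r"
  have I: "0 < I" using bump_mass_pos[OF r(1)] by (simp add: I_def)
  let ?T = "mollify a b r G" and ?T' = "mollify_grad a b r G"
  have T': "\<bar>?T' x \<bullet> B w - I * (f x \<bullet> w)\<bar> \<le> I * (e / 2 * norm w)" if x: "x \<in> K" for x w
    unfolding I_def
  proof (rule mollify_grad_directional[OF G(1) r(1)])
    show "ball x (2 * r) \<subseteq> cbox a b" using ab[OF x] r by simp
    fix y s assume s: "0 < (s::real)" "y \<in> ball x (2 * r)" "y + s *\<^sub>R B w \<in> ball x (2 * r)"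
    have Bs: "s *\<^sub>R B w = B (s *\<^sub>R w)" by (simp add: linear_scale[OF B])
    have "\<bar>G (y + B (s *\<^sub>R w)) - G y - f x \<bullet> (s *\<^sub>R w)\<bar> \<le> e / 2 * norm (s *\<^sub>R w)"
      using G(3) x s unfolding locally_fits_def r e1 Bs by blast
    then show "\<bar>G (y + s *\<^sub>R B w) - G y - s * (f x \<bullet> w)\<bar> \<le> s * (e / 2 * norm w)"
      using s(1) by (simp add: Bs mult_ac)
  qed
  define \<delta> where "\<delta> = e / (2 * \<Lambda>)"
  have \<delta>: "0 < \<delta>" "\<delta> * \<Lambda> = e / 2" using e \<Lambda>(1) by (auto simp: \<delta>_def)
  have approx: "C1_approx \<sigma> \<sigma>' K (\<lambda>x. 1 / I * ?T x) (\<lambda>x. (1 / I) *\<^sub>R ?T' x)"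
    by (intro C1_approx_scale C1_approx_mollify \<sigma> K G(1))
  obtain n n' where n: "ridge_sum \<sigma> \<sigma>' n n'"
    "\<And>x. x \<in> K \<Longrightarrow> norm (n' x - (1 / I) *\<^sub>R ?T' x) \<le> \<delta>"
    using approx[unfolded C1_approx_def, rule_format, OF \<delta>(1)] by auto
  have "\<bar>n' x \<bullet> B w - f x \<bullet> w\<bar> \<le> e * norm w" if x: "x \<in> K" for x w
  proof -
    have "\<bar>(n' x - (1 / I) *\<^sub>R ?T' x) \<bullet> B w\<bar> \<le> norm (n' x - (1 / I) *\<^sub>R ?T' x) * norm (B w)"
      by (rule Cauchy_Schwarz_ineq2)
    also have "\<dots> \<le> \<delta> * (\<Lambda> * norm w)"
      using n(2)[OF x] \<Lambda>(2)[of w] \<delta>(1) by (intro mult_mono) auto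
    also have "\<dots> = e / 2 * norm w" using \<delta>(2) by (simp flip: mult.assoc)
    finally have 1: "\<bar>n' x \<bullet> B w - (?T' x \<bullet> B w) / I\<bar> \<le> e / 2 * norm w"
      by (simp add: inner_diff_left)
    have "(?T' x \<bullet> B w) / I - f x \<bullet> w = (?T' x \<bullet> B w - I * (f x \<bullet> w)) / I"
      using I by (simp add: field_simps)
    then have "\<bar>(?T' x \<bullet> B w) / I - f x \<bullet> w\<bar> = \<bar>?T' x \<bullet> B w - I * (f x \<bullet> w)\<bar> / I"
      using I by (simp add: abs_divide)
    also have "\<dots> \<le> I * (e / 2 * norm w) / I"
      using T'[OF x, of w] I by (intro divide_right_mono) auto
    also have "\<dots> = e / 2 * norm w" using I by simp
    finally show ?thesis using 1 by linarith
  qed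
  then show ?thesis using that n(1) by blast
qed

section \<open>From uniform approximation to the theorem\<close>

lemma L2_norm_le_sup:
  fixes F :: "'a::euclidean_space \<Rightarrow> 'b::euclidean_space"
  assumes K: "compact K" and F: "continuous_on K F" and e: "0 \<le> e" "\<And>x. x \<in> K \<Longrightarrow> norm (F x) \<le> e"
  shows "in_L2 K F" "L2_norm K F \<le> e * sqrt (measure lebesgue K)"
proof -
  have Kl: "K \<in> lmeasurable" by (rule lmeasurable_compact[OF K])
  interpret finite_measure "lebesgue_on K" by (rule finite_measure_lebesgue_on[OF Kl])
  have Ks: "K \<in> sets lebesgue" using Kl by blast
  have meas: "F \<in> borel_measurable (lebesgue_on K)"
    "(\<lambda>x. (norm (F x))\<^sup>2) \<in> borel_measurable (lebesgue_on K)"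
    by (intro continuous_imp_measurable_on_sets_lebesgue continuous_intros F Ks)+
  have le: "(norm (F x))\<^sup>2 \<le> e\<^sup>2" if "x \<in> K" for x
    using e(2)[OF that] by (intro power_mono) auto
  have int: "integrable (lebesgue_on K) (\<lambda>x. (norm (F x))\<^sup>2)"
    by (rule integrable_const_bound[OF _ meas(2), of "e\<^sup>2"]) (use le in \<open>auto intro!: AE_I2\<close>)
  show "in_L2 K F" using meas(1) int by (simp add: in_L2_def)
  have "integral\<^sup>L (lebesgue_on K) (\<lambda>x. (norm (F x))\<^sup>2) \<le> integral\<^sup>L (lebesgue_on K) (\<lambda>x. e\<^sup>2)"
    by (rule integral_mono[OF int]) (use le in auto)
  also have "\<dots> = e\<^sup>2 * measure lebesgue K"
    using Ks by (simp add: measure_restrict_space)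
  finally have "L2_norm K F \<le> sqrt (e\<^sup>2 * measure lebesgue K)"
    unfolding L2_norm_def by (rule real_sqrt_le_mono)
  then show "L2_norm K F \<le> e * sqrt (measure lebesgue K)"
    using e(1) by (simp add: real_sqrt_mult)
qed

lemma C_k_add: "C_k k f \<Longrightarrow> C_k k g \<Longrightarrow> C_k k (\<lambda>x. f x + g x)"
proof (induction k arbitrary: f g)
  case 0
  then show ?case by (auto intro: continuous_on_add)
next
  case (Suc k)
  have "frechet_derivative (\<lambda>x. f x + g x) (at x) b
      = frechet_derivative f (at x) b + frechet_derivative g (at x) b" for x b
  proof -
    have "((\<lambda>x. f x + g x) has_derivative
        (\<lambda>h. frechet_derivative f (at x) h + frechet_derivative g (at x) h)) (at x)"
      using Suc.prems by (intro has_derivative_add) (simp_all add: frechet_derivative_works[symmetric])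
    from frechet_derivative_at[OF this] show ?thesis by metis
  qed
  then show ?case using Suc by (auto intro!: differentiable_add)
qed

lemma C_k_ridge:
  fixes a :: "'a::euclidean_space" and s :: "real \<Rightarrow> real"
  shows "C_k k s \<Longrightarrow> C_k k (\<lambda>x. \<beta> * s (a \<bullet> x + b))"
proof (induction k arbitrary: s \<beta>)
  case 0
  then have "continuous_on UNIV s" by simp
  then show ?case by (auto intro!: continuous_intros continuous_on_compose2[of UNIV s])
next
  case (Suc k)
  define s' where "s' t = frechet_derivative s (at t) 1" for t
  have s': "C_k k s'" using Suc.prems by (simp add: s'_def[abs_def])
  have "DERIV s t :> s' t" for t
  proof -
    have D: "(s has_derivative frechet_derivative s (at t)) (at t)"
      using Suc.prems frechet_derivative_works by auto
    have "frechet_derivative s (at t) h = s' t * h" for h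
      using linear_scale[OF has_derivative_linear[OF D], of h 1]
      by (simp add: s'_def mult.commute)
    then have "frechet_derivative s (at t) = (*) (s' t)" by (rule ext)
    then show ?thesis using D by (simp add: has_field_derivative_def)
  qed
  then have "DERIV (\<lambda>t. \<beta> * s t) t :> \<beta> * s' t" for t by (rule DERIV_cmult)
  moreover have "GDERIV (\<lambda>x. a \<bullet> x + b) x :> a" for x
    unfolding gderiv_def by (auto intro!: derivative_eq_intros simp: inner_commute)
  ultimately have D: "((\<lambda>x. \<beta> * s (a \<bullet> x + b)) has_derivative
      (\<lambda>h. h \<bullet> ((\<beta> * s' (a \<bullet> x + b)) *\<^sub>R a))) (at x)" for x
    using GDERIV_DERIV_compose unfolding gderiv_def by blast
  have "frechet_derivative (\<lambda>x. \<beta> * s (a \<bullet> x + b)) (at x) v = (\<beta> * (v \<bullet> a)) * s' (a \<bullet> x + b)" for x v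
    using frechet_derivative_at[OF D[of x]] by (metis inner_scaleR_right mult.assoc mult.commute)
  moreover have "(\<lambda>x. \<beta> * s (a \<bullet> x + b)) differentiable (at x)" for x
    using D by (auto simp: differentiable_def)
  ultimately show ?case using Suc.IH[OF s'] by simp
qed

lemma ridge_sum_C_inf:
  assumes "ridge_sum \<sigma> \<sigma>' n n'" "C_inf \<sigma>"
  shows "C_inf n"
  using assms(1)
  by (induction rule: ridge_sum.induct) (use assms(2) in \<open>auto simp: C_inf_def C_k_ridge C_k_add\<close>)

lemma ridge_sum_neural_network:
  assumes "ridge_sum \<sigma> \<sigma>' n n'"
  shows "n \<in> neural_networks \<sigma>"
  using assms
proof (induction rule: ridge_sum.induct)
  case (neuron \<beta> a b)
  show ?case unfolding neural_networks_def
    by (intro CollectI exI[of _ 1] exI[of _ "\<lambda>_. \<beta>"] exI[of _ "\<lambda>_. a"] exI[of _ "\<lambda>_. b"]) simp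
next
  case (add n n' m m')
  obtain q :: nat and \<beta> a b where n: "n = (\<lambda>x. \<Sum>j<q. \<beta> j * \<sigma> (a j \<bullet> x + b j))"
    using add.IH(1) unfolding neural_networks_def by blast
  obtain p :: nat and \<beta>' a' b' where m: "m = (\<lambda>x. \<Sum>j<p. \<beta>' j * \<sigma> (a' j \<bullet> x + b' j))"
    using add.IH(2) unfolding neural_networks_def by blast
  have "(\<Sum>j<q + p. F j) = (\<Sum>j<q. F j) + (\<Sum>j<p. F (q + j))" for F :: "nat \<Rightarrow> real"
    by (induction p) auto
  then have "(\<lambda>x. n x + m x) = (\<lambda>x. \<Sum>j<q + p. (if j < q then \<beta> j else \<beta>' (j - q)) *
      \<sigma> ((if j < q then a j else a' (j - q)) \<bullet> x + (if j < q then b j else b' (j - q))))"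
    by (simp add: n m)
  then show ?case
    unfolding neural_networks_def
    by (intro CollectI exI[of _ "q + p"] exI[of _ "\<lambda>j. if j < q then \<beta> j else \<beta>' (j - q)"]
        exI[of _ "\<lambda>j. if j < q then a j else a' (j - q)"]
        exI[of _ "\<lambda>j. if j < q then b j else b' (j - q)"])
qed

theorem theorem4:
  fixes H :: "real ^ 'n \<Rightarrow> real"
    and S :: "real ^ 'n ^ 'n"
    and K :: "(real ^ 'n) set"
    and \<sigma> :: "real \<Rightarrow> real"
  assumes "\<forall>x. H differentiable (at x)"
    and "transpose S = - S"
    and "compact K"
    and "\<exists>L. L-lipschitz_on K (\<lambda>u. S *v gradient H u)"
    and "\<sigma> \<in> S12"
    and "\<sigma> \<noteq> (\<lambda>x. 0)"
  shows "(\<forall>\<epsilon>>0. \<exists>HNN \<in> neural_networks \<sigma>.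
            in_L2 K (\<lambda>u. S *v gradient H u - S *v gradient HNN u) \<and>
            L2_norm K (\<lambda>u. S *v gradient H u - S *v gradient HNN u) < \<epsilon>) \<and>
         (C_inf H \<and> C_inf \<sigma> \<longrightarrow>
           (\<forall>\<epsilon>>0. \<exists>HNN \<in> neural_networks \<sigma>. C_inf HNN \<and>
              in_L2 K (\<lambda>u. S *v gradient H u - S *v gradient HNN u) \<and>
              L2_norm K (\<lambda>u. S *v gradient H u - S *v gradient HNN u) < \<epsilon>))"
proof -
  have "\<sigma> C1_differentiable_on UNIV" using assms(5) by (simp add: S12_def)
  then obtain \<sigma>' where \<sigma>': "\<And>t. DERIV \<sigma> t :> \<sigma>' t" "continuous_on UNIV \<sigma>'"
    unfolding C1_differentiable_on_def has_real_derivative_iff_has_vector_derivative by blast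
  have "integrable lebesgue (\<lambda>t. (\<sigma> t)\<^sup>2)"
    using assms(5) by (simp add: S12_def in_L2_def lebesgue_on_UNIV_eq)
  moreover have "(\<lambda>t. (\<sigma> t)\<^sup>2) \<in> borel_measurable lborel"
    using borel_measurable_continuous_onI[OF DERIV_imp_continuous_on[OF \<sigma>'(1)]] by simp
  ultimately have int: "integrable lborel (\<lambda>t. (\<sigma> t)\<^sup>2)"
    using integrable_completion by blast
  have H: "GDERIV H x :> gradient H x" for x
  proof -
    obtain D where D: "(H has_derivative D) (at x)"
      using assms(1) unfolding differentiable_def by blast
    define c where "c = adjoint D 1"
    have "D = (\<lambda>h. h \<bullet> c)"
      using adjoint_works[OF has_derivative_linear[OF D], of _ 1] by (auto simp: c_def)
    then have "GDERIV H x :> c" using D by (simp add: gderiv_def)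
    then show ?thesis using gradient_eqI by metis
  qed
  define f where "f u = S *v gradient H u" for u
  have cont: "continuous_on K f"
    using assms(4) lipschitz_on_continuous_on unfolding f_def[abs_def] by blast
  have S: "(S *v u) \<bullet> w = u \<bullet> (transpose S *v w)" for u w
    using dot_lmul_matrix[of w S u] by (simp add: inner_commute)
  have main: "\<exists>HNN\<in>neural_networks \<sigma>. (C_inf \<sigma> \<longrightarrow> C_inf HNN) \<and>
      in_L2 K (\<lambda>u. S *v gradient H u - S *v gradient HNN u) \<and>
      L2_norm K (\<lambda>u. S *v gradient H u - S *v gradient HNN u) < \<epsilon>" if \<epsilon>: "0 < \<epsilon>" for \<epsilon>
  proof -
    define m where "m = sqrt (measure lebesgue K)"
    define e where "e = \<epsilon> / (m + 1)"
    have m: "0 \<le> m" by (simp add: m_def)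
    have e: "0 < e" "e * m < \<epsilon>" using \<epsilon> m by (auto simp: e_def field_simps)
    obtain n n' where n: "ridge_sum \<sigma> \<sigma>' n n'"
      "\<And>x w. x \<in> K \<Longrightarrow> \<bar>n' x \<bullet> (transpose S *v w) - f x \<bullet> w\<bar> \<le> e * norm w"
      using C1_uniform_approximation[OF \<sigma>' int assms(6) assms(3) H _ cont matrix_vector_mul_linear e(1)]
        S unfolding f_def by metis
    have grad: "gradient n u = n' u" for u
      by (rule gradient_eqI[OF ridge_sum_GDERIV[OF n(1) \<sigma>'(1)]])
    define F where "F u = S *v gradient H u - S *v gradient n u" for u
    have cF: "continuous_on K F"
    proof -
      have "continuous_on K n'"
        using ridge_sum_continuous_gradient[OF n(1) \<sigma>'(2)] continuous_on_subset by blast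
      then have "continuous_on K (\<lambda>u. S *v n' u)"
        by (rule linear_continuous_on_compose[OF _ matrix_vector_mul_linear])
      then show ?thesis unfolding F_def grad by (intro continuous_on_diff cont[unfolded f_def])
    qed
    have "norm (F u) \<le> e" if u: "u \<in> K" for u
    proof -
      \<comment> \<open>The bound on all inner products \<open>F u \<bullet> w\<close> is a bound on the norm: take \<open>w = F u\<close>.\<close>
      have "F u \<bullet> F u = f u \<bullet> F u - n' u \<bullet> (transpose S *v F u)"
        unfolding S[symmetric] by (subst (1) F_def) (simp add: f_def grad inner_diff_left)
      also have "\<dots> \<le> e * norm (F u)" using n(2)[OF u, of "F u"] by linarith
      finally have "norm (F u) * norm (F u) \<le> e * norm (F u)"
        by (simp add: power2_norm_eq_inner flip: power2_eq_square)
      then show ?thesis using e(1) by (cases "F u = 0") auto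
    qed
    from L2_norm_le_sup[OF assms(3) cF less_imp_le[OF e(1)] this]
    have "in_L2 K F" "L2_norm K F < \<epsilon>" using e(2) by (auto simp: m_def)
    then show ?thesis
      using ridge_sum_neural_network[OF n(1)] ridge_sum_C_inf[OF n(1)]
      unfolding F_def[abs_def] by blast
  qed
  then show ?thesis by blast
qed

end
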